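(* Let $q>2$ be a prime power. Then $\zeta_A(1,q(q-1),q^3-q^2+q-1)$ is zeta-like; more precisely, $$\zeta_A(1,q(q-1),q^3-q^2+q-1)=\frac{[3]-1}{[3]\,[2]\,[1]^{q^2-q+1}}\,\zeta_A(q^3).$$
   Context: $A=\mathbb{F}_q[\theta]$, $A_+$ the monic polynomials, $K=\mathbb{F}_q(\theta)$, $[k]=\theta^{q^k}-\theta$. For $s\in\mathbb{Z}$, $d\ge0$ let $S_d(s)=\sum_{a\in A_+,\deg a=d}a^{-s}$. For positive integers $s_1,\dots,s_r$, $\zeta_A(s_1,\dots,s_r)=\sum_{d_1>\cdots>d_r\ge0}S_{d_1}(s_1)\cdots S_{d_r}(s_r)$, and $\zeta_A(k)=\sum_{a\in A_+}a^{-k}$. A multizeta value of weight $w=\sum s_i$ is zeta-like if $\zeta_A(s_1,\dots,s_r)/\zeta_A(w)\in K$. *)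

theory Defs
  imports "HOL-Analysis.Analysis" "HOL-Computational_Algebra.Computational_Algebra"
begin

text \<open>
  The finite field \<open>\<F>\<^sub>q\<close> is a type \<open>'a :: {finite, field}\<close> with \<open>q = CARD('a)\<close>.
  All values live in \<open>K\<^sub>\<infinity> = \<F>\<^sub>q((1/\<theta>))\<close>, represented by the
  type \<open>'a fls\<close> with the formal variable playing the role of \<open>1/\<theta>\<close>;
  its metric is the \<open>1/\<theta>\<close>-adic one.
\<close>

definition theta :: "'a :: field fls" where
  "theta = fls_X_inv"

definition poly_emb :: "'a :: field poly \<Rightarrow> 'a fls" where
  "poly_emb a = poly (map_poly fls_const a) theta"

text \<open>The rational function field \<open>K = \<F>\<^sub>q(\<theta>)\<close> as a subfield of \<open>K\<^sub>\<infinity>\<close>.\<close>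

definition ratfun_field :: "'a :: field fls set" where
  "ratfun_field = {poly_emb a / poly_emb b | a b. b \<noteq> 0}"

definition bracket :: "nat \<Rightarrow> 'a :: {finite, field} fls" where
  "bracket k = theta ^ (CARD('a) ^ k) - theta"

definition power_sum :: "nat \<Rightarrow> int \<Rightarrow> 'a :: {finite, field} fls" where
  "power_sum d s = (\<Sum>a | lead_coeff a = 1 \<and> degree a = d. poly_emb a powi (- s))"

definition carlitz_zeta :: "int \<Rightarrow> 'a :: {finite, field} fls" where
  "carlitz_zeta k = (\<Sum>\<^sub>\<infinity>a | lead_coeff a = 1. poly_emb a powi (- k))"

definition multizeta :: "int list \<Rightarrow> 'a :: {finite, field} fls" where
  "multizeta ss =
     (\<Sum>\<^sub>\<infinity>ds | length ds = length ss \<and> sorted_wrt (>) ds.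
        \<Prod>i<length ss. power_sum (ds ! i) (ss ! i))"

definition zeta_like :: "'a :: {finite, field} itself \<Rightarrow> int list \<Rightarrow> bool" where
  "zeta_like _ ss \<longleftrightarrow>
     multizeta ss / carlitz_zeta (sum_list ss) \<in> (ratfun_field :: 'a fls set)"

text \<open>
  Since \<open>infsum\<close> is \<open>0\<close> for divergent families and \<open>x / 0 = 0\<close>, the
  remaining facts record that for positive arguments both zeta sums converge and that
  the denominator in \<open>zeta_like\<close> does not vanish.
\<close>

lemma fls_has_sumI:
  fixes f :: "'b \<Rightarrow> 'a :: ab_group_add fls"
  assumes fin: "\<And>N. finite {x \<in> A. \<exists>k<N. fls_nth (f x) k \<noteq> 0}"
    and nonneg: "\<And>x k. x \<in> A \<Longrightarrow> k < 0 \<Longrightarrow> fls_nth (f x) k = 0"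
  shows "\<exists>S. (f has_sum S) A \<and>
    (\<forall>k. fls_nth S k = (\<Sum>x\<in>{x \<in> A. fls_nth (f x) k \<noteq> 0}. fls_nth (f x) k))"
proof -
  define c where "c = (\<lambda>k. \<Sum>x\<in>{x \<in> A. fls_nth (f x) k \<noteq> 0}. fls_nth (f x) k)"
  have c0: "c k = 0" if "k < 0" for k
    using nonneg that by (auto simp: c_def intro: sum.neutral)
  have nth: "fls_nth (Abs_fls c) k = c k" for k
    by (rule nth_Abs_fls_lower_bound[of 0]) (auto simp: c0)
  have key: "fls_nth (sum f Y) k = c k"
    if "finite Y" "Y \<subseteq> A" "{x \<in> A. \<exists>k<int N. fls_nth (f x) k \<noteq> 0} \<subseteq> Y" "k < int N" for Y N k
    unfolding fls_nth_sum c_def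
    by (rule sum.mono_neutral_right) (use that in auto)
  have "(sum f \<longlongrightarrow> Abs_fls c) (finite_subsets_at_top A)"
  proof (rule tendstoI)
    fix e :: real assume "e > 0"
    then obtain N where N: "inverse (2 ^ N) < e"
      using real_arch_pow_inv[of e "1/2"] by (auto simp: power_divide inverse_eq_divide)
    show "\<forall>\<^sub>F Y in finite_subsets_at_top A. dist (sum f Y) (Abs_fls c) < e"
      unfolding eventually_finite_subsets_at_top
    proof (intro exI[of _ "{x \<in> A. \<exists>k<int N. fls_nth (f x) k \<noteq> 0}"] conjI allI impI)
      show "finite {x \<in> A. \<exists>k<int N. fls_nth (f x) k \<noteq> 0}" by (rule fin)
      fix Y assume Y: "finite Y \<and> {x \<in> A. \<exists>k<int N. fls_nth (f x) k \<noteq> 0} \<subseteq> Y \<and> Y \<subseteq> A"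
      show "dist (sum f Y) (Abs_fls c) < e"
      proof (cases "sum f Y = Abs_fls c")
        case False
        have "int N \<le> fls_subdegree (sum f Y - Abs_fls c)"
          by (rule fls_subdegree_geI) (use False key[of Y N] Y nth in auto)
        moreover from this have "inverse (2 ^ nat (fls_subdegree (sum f Y - Abs_fls c)))
            \<le> (inverse (2 ^ N) :: real)"
          by (intro le_imp_inverse_le power_increasing) auto
        ultimately show ?thesis
          using N False unfolding dist_fls_def by (smt (verit) of_nat_0_le_iff)
      qed (use \<open>e > 0\<close> in simp)
    qed auto
  qed
  then show ?thesis
    using nth by (auto simp: has_sum_def c_def intro!: exI[of _ "Abs_fls c"])
qed

lemma fls_nth_poly_emb: "fls_nth (poly_emb a) k = (if k \<le> 0 then coeff a (nat (- k)) else 0)"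
proof -
  have *: "degree (map_poly fls_const a) = degree a"
    by (intro degree_map_poly) auto
  have "fls_nth (poly_emb a) k
      = (\<Sum>i\<le>degree a. coeff a i * (if k = - int i then 1 else 0))"
    unfolding poly_emb_def theta_def poly_altdef *
    by (simp add: fls_nth_sum coeff_map_poly fls_X_inv_power_nth)
  also have "\<dots> = (\<Sum>i\<le>degree a. if i = nat (- k) then (if k \<le> 0 then coeff a i else 0) else 0)"
    by (intro sum.cong) auto
  also have "\<dots> = (if k \<le> 0 then coeff a (nat (- k)) else 0)"
    by (auto simp: coeff_eq_0)
  finally show ?thesis .
qed

lemma fls_subdegree_poly_emb:
  assumes "a \<noteq> 0"
  shows "fls_subdegree (poly_emb a) = - int (degree a)"
  using assms by (intro fls_subdegree_eqI) (auto simp: fls_nth_poly_emb coeff_eq_0)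

lemma fls_subdegree_poly_emb_powi:
  assumes "lead_coeff a = 1"
  shows "fls_subdegree (poly_emb a powi (- s)) = int (degree a) * s"
proof -
  have "a \<noteq> 0" using assms by auto
  then show ?thesis by (simp add: fls_subdegree_poly_emb)
qed

lemma finite_degree_le: "finite {a :: 'a :: {finite, zero} poly. degree a \<le> d}"
proof (rule finite_subset)
  show "{a :: 'a poly. degree a \<le> d} \<subseteq> Poly ` {xs. set xs \<subseteq> UNIV \<and> length xs \<le> Suc d}"
  proof
    fix a :: "'a poly" assume "a \<in> {a. degree a \<le> d}"
    then have "length (coeffs a) \<le> Suc d" by (auto simp: length_coeffs_degree coeffs_eq_Nil)
        (metis Suc_le_mono coeffs_eq_Nil le0 length_coeffs_degree list.size(3))
    then show "a \<in> Poly ` {xs. set xs \<subseteq> UNIV \<and> length xs \<le> Suc d}"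
      by (intro image_eqI[of _ _ "coeffs a"]) auto
  qed
qed (intro finite_imageI finite_lists_length_le finite)

lemma carlitz_zeta_aux:
  assumes "k > 0"
  shows "\<exists>S. ((\<lambda>a :: 'a :: {finite, field} poly. poly_emb a powi (- k)) has_sum S)
    {a. lead_coeff a = 1} \<and> fls_nth S 0 = 1"
proof -
  have le: "int (degree a) \<le> j"
    if "lead_coeff a = 1" "fls_nth (poly_emb a powi (- k)) j \<noteq> 0" for a :: "'a poly" and j
  proof -
    have "int (degree a) * k \<le> j"
      using fls_subdegree_leI[OF that(2)] fls_subdegree_poly_emb_powi[OF that(1), of k] by simp
    moreover have "int (degree a) * 1 \<le> int (degree a) * k"
      using assms by (intro mult_left_mono) auto
    ultimately show ?thesis by linarith
  qed
  have "\<exists>S. ((\<lambda>a :: 'a poly. poly_emb a powi (- k)) has_sum S) {a. lead_coeff a = 1} \<and>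
    (\<forall>j. fls_nth S j = (\<Sum>a\<in>{a \<in> {a. lead_coeff a = 1}. fls_nth (poly_emb a powi (- k)) j \<noteq> 0}.
      fls_nth (poly_emb a powi (- k)) j))"
  proof (rule fls_has_sumI)
    fix N :: int
    show "finite {a :: 'a poly \<in> {a. lead_coeff a = 1}.
        \<exists>j<N. fls_nth (poly_emb a powi (- k)) j \<noteq> 0}"
      by (rule finite_subset[OF _ finite_degree_le[of "nat N"]]) (use le in fastforce)
  next
    fix a :: "'a poly" and j :: int assume "a \<in> {a. lead_coeff a = 1}" "j < 0"
    then show "fls_nth (poly_emb a powi (- k)) j = 0" using le[of a j] by fastforce
  qed
  then obtain S where S: "((\<lambda>a :: 'a poly. poly_emb a powi (- k)) has_sum S) {a. lead_coeff a = 1}"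
    "fls_nth S 0 = (\<Sum>a\<in>{a :: 'a poly. lead_coeff a = 1 \<and> fls_nth (poly_emb a powi (- k)) 0 \<noteq> 0}.
      fls_nth (poly_emb a powi (- k)) 0)"
    by auto
  have one: "poly_emb (1 :: 'a poly) = 1"
    by (simp add: poly_emb_def map_poly_1)
  have "{a :: 'a poly. lead_coeff a = 1 \<and> fls_nth (poly_emb a powi (- k)) 0 \<noteq> 0} = {1}"
  proof (intro equalityI subsetI)
    fix a :: "'a poly"
    assume a: "a \<in> {a. lead_coeff a = 1 \<and> fls_nth (poly_emb a powi (- k)) 0 \<noteq> 0}"
    then have "degree a = 0" using le[of a 0] by simp
    with a show "a \<in> {1}" by (auto elim!: degree_eq_zeroE)
  qed (simp add: one)
  with S show ?thesis by (auto simp: one)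
qed

lemma carlitz_zeta_summable:
  assumes "k > 0"
  shows "(\<lambda>a :: 'a :: {finite, field} poly. poly_emb a powi (- k)) summable_on {a. lead_coeff a = 1}"
  using carlitz_zeta_aux[OF assms] by (auto simp: summable_on_def)

lemma carlitz_zeta_nonzero:
  assumes "k > 0"
  shows "(carlitz_zeta k :: 'a :: {finite, field} fls) \<noteq> 0"
  using carlitz_zeta_aux[OF assms, where 'a = 'a] by (auto simp: carlitz_zeta_def dest: infsumI)

lemma fls_nth_power_sum_eq_0:
  assumes "j < int d * s"
  shows "fls_nth (power_sum d s) j = 0"
  unfolding power_sum_def fls_nth_sum
  by (rule sum.neutral) (use assms fls_subdegree_poly_emb_powi in fastforce)

lemma multizeta_summable:
  assumes pos: "\<forall>s\<in>set ss. s > 0"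
  shows "(\<lambda>ds. \<Prod>i<length ss. power_sum (ds ! i) (ss ! i) :: 'a :: {finite, field} fls)
    summable_on {ds. length ds = length ss \<and> sorted_wrt (>) ds}"
proof -
  have prod_le: "(\<Sum>i<n. g i) \<le> j"
    if "\<And>i j. i < n \<Longrightarrow> j < g i \<Longrightarrow> fls_nth (F i) j = 0" "fls_nth (\<Prod>i<n. F i) j \<noteq> 0"
    for F :: "nat \<Rightarrow> 'a fls" and g :: "nat \<Rightarrow> int" and n j
    using that
  proof (induction n arbitrary: j)
    case 0
    then show ?case by (auto split: if_splits)
  next
    case (Suc n)
    let ?P = "\<Prod>i<n. F i"
    have nz: "?P \<noteq> 0" "F n \<noteq> 0" using Suc.prems(2) by (auto simp del: prod_zero_iff)
    have "(\<Sum>i<n. g i) \<le> fls_subdegree ?P"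
      using nz Suc.prems(1) by (intro Suc.IH) (auto simp: nth_fls_subdegree_nonzero)
    moreover have "g n \<le> fls_subdegree (F n)"
      using nz Suc.prems(1) by (intro fls_subdegree_geI) auto
    moreover have "fls_subdegree (?P * F n) \<le> j"
      using Suc.prems(2) by (intro fls_subdegree_leI) simp
    ultimately show ?case using nz by simp
  qed
  define F where "F = (\<lambda>ds. \<Prod>i<length ss. power_sum (ds ! i) (ss ! i) :: 'a fls)"
  have le: "j \<ge> 0 \<and> set ds \<subseteq> {..nat j}"
    if ds: "length ds = length ss" and nz: "fls_nth (F ds) j \<noteq> 0" for ds j
  proof -
    have "(\<Sum>i<length ss. int (ds ! i) * ss ! i) \<le> j"
      by (rule prod_le[OF _ nz[unfolded F_def]]) (rule fls_nth_power_sum_eq_0)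
    moreover have "(\<Sum>i<length ss. int (ds ! i) * 1) \<le> (\<Sum>i<length ss. int (ds ! i) * ss ! i)"
      by (intro sum_mono mult_left_mono) (use pos nth_mem in fastforce)+
    ultimately have *: "(\<Sum>i<length ss. int (ds ! i)) \<le> j" by simp
    have "int (ds ! i) \<le> j" if "i < length ss" for i
      using member_le_sum[of i "{..<length ss}" "\<lambda>i. int (ds ! i)"] that * by auto
    moreover have "j \<ge> 0" using * sum_nonneg[of "{..<length ss}" "\<lambda>i. int (ds ! i)"] by simp
    ultimately show ?thesis using ds by (auto simp: in_set_conv_nth nat_le_eq_zle) (use le_nat_iff in fastforce)
  qed
  have "\<exists>S. (F has_sum S) {ds. length ds = length ss \<and> sorted_wrt (>) ds} \<and>
    (\<forall>k. fls_nth S k = (\<Sum>ds\<in>{ds \<in> {ds. length ds = length ss \<and> sorted_wrt (>) ds}.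
      fls_nth (F ds) k \<noteq> 0}. fls_nth (F ds) k))"
  proof (rule fls_has_sumI)
    fix N :: int
    have "{ds \<in> {ds. length ds = length ss \<and> sorted_wrt (>) ds}. \<exists>j<N. fls_nth (F ds) j \<noteq> 0}
        \<subseteq> {ds. set ds \<subseteq> {..nat N} \<and> length ds = length ss}"
      using le by (fastforce simp: subset_iff)
    then show "finite {ds \<in> {ds. length ds = length ss \<and> sorted_wrt (>) ds}.
        \<exists>j<N. fls_nth (F ds) j \<noteq> 0}"
      by (rule finite_subset) (rule finite_lists_length_eq, simp)
  next
    fix ds :: "nat list" and j :: int
    assume "ds \<in> {ds. length ds = length ss \<and> sorted_wrt (>) ds}" "j < 0"
    then show "fls_nth (F ds) j = 0" using le[of ds j] by fastforce
  qed
  then show ?thesis by (auto simp: summable_on_def F_def)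
qed

end

theory Submission
  imports Defs
begin

text \<open>
  Write \<open>[k]\<close> for \<open>bracket k\<close>, let \<open>E\<^sub>0 = x\<close> and \<open>[d + 1] E\<^bsub>d+1\<^esub> = E\<^sub>d\<^sup>q - E\<^sub>d\<close>
  be the Carlitz polynomials, and let \<open>c\<close> be the linear coefficient of \<open>E\<^sub>d\<close>. The rule
  \<open>E\<^bsub>d+1\<^esub>(\<theta> x) = \<theta> E\<^bsub>d+1\<^esub>(x) + E\<^sub>d(x)\<^sup>q\<close> shows that \<open>E\<^sub>d\<close> vanishes at the polynomials of
  degree less than \<open>d\<close> and is \<open>1\<close> at the monic ones of degree \<open>d\<close>; so \<open>1 - E\<^sub>d\<close> and
  \<open>E\<^sub>d / (c x)\<close> are products of factors \<open>1 - x / a\<close>, and Newton's identities turn their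
  coefficients into power sums. The first product gives \<open>S\<^sub>d(k) = c\<^sup>k\<close> for \<open>0 < k \<le> q\<close>. As
  \<open>N = q\<^sup>3 - q\<^sup>2 + q - 1\<close> is a multiple of \<open>q - 1\<close>, the second one gives, with
  \<open>C = [1]\<^bsup>q^2-q+1\<^esup> [2]\<close>,
  \<open>\<Sum>j<d. S\<^sub>j(N) = c\<^sup>N [d]\<^bsup>q^3\<^esup> [d + 1] / C\<close>.
  The next level of the nested sum telescopes as well: its truncation at \<open>d\<close> is
  \<open>c\<^bsup>q^3-1\<^esup> [d]\<^bsup>q^3\<^esup> ([d + 2] - [3]) [d + 1] / (C [3])\<close>. After multiplication by
  \<open>S\<^sub>d(1) = c\<close> the term of index \<open>d + 2\<close> is \<open>S\<^sub>d(q\<^sup>3) [d + 3] / (C [3])\<close>, and since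
  \<open>[d + 3] = [d]\<^bsup>q^3\<^esup> + [3]\<close> and \<open>S\<^sub>d(q\<^sup>3) [d]\<^bsup>q^3\<^esup> = - S\<^bsub>d-1\<^esub>(q\<^sup>3)\<close>, these terms sum to
  \<open>([3] - 1) / (C [3])\<close> times the zeta value.
\<close>

section \<open>Finite fields, roots and power sums\<close>

lemma field_power_card_minus_1:
  fixes x :: "'a :: {finite, field}"
  assumes "x \<noteq> 0"
  shows "x ^ (CARD('a) - 1) = 1"
proof -
  have "(\<Prod>y\<in>UNIV - {0}. x * y) = \<Prod>(UNIV - {0})"
    by (rule prod.reindex_bij_witness[of _ "\<lambda>y. y / x" "\<lambda>y. x * y"]) (use assms in auto)
  then have "x ^ (CARD('a) - 1) * \<Prod>(UNIV - {0}) = \<Prod>(UNIV - {0})"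
    by (simp add: prod.distrib card_Diff_singleton)
  then show ?thesis by simp
qed

lemma field_power_card:
  fixes x :: "'a :: {finite, field}"
  shows "x ^ CARD('a) = x"
proof (cases "x = 0")
  case False
  have "x ^ CARD('a) = x * x ^ (CARD('a) - 1)"
    by (subst power_Suc[symmetric]) simp
  also have "\<dots> = x" using field_power_card_minus_1[OF False] by simp
  finally show ?thesis .
qed (simp add: power_0_left)

text \<open>The polynomial (x + 1)^q - x^q - 1 has degree below q but vanishes at all q field
  elements because x^q = x there. So its coefficients, the inner binomials, are zero.\<close>

lemma binomial_card_field_eq_0:
  assumes "0 < k" "k < CARD('a)"
  shows "(of_nat (CARD('a) choose k) :: 'a :: {finite, field}) = 0"
proof -
  let ?q = "CARD('a)"
  have q: "?q > 0" by simp
  define p :: "'a poly" where "p = (\<Sum>k\<in>{0<..<?q}. monom (of_nat (?q choose k)) k)"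
  have coeff_p: "coeff p k = (if k \<in> {0<..<?q} then of_nat (?q choose k) else 0)" for k
    by (simp add: p_def coeff_sum if_distrib cong: if_cong)
  have eval: "poly p x = 0" for x
  proof -
    have "(x + 1) ^ ?q = (\<Sum>k\<le>?q. of_nat (?q choose k) * x ^ k)"
      by (simp add: binomial_ring)
    also have "{..?q} = insert 0 (insert ?q {0<..<?q})" by (auto simp: Suc_leI)
    also have "(\<Sum>k\<in>\<dots>. of_nat (?q choose k) * x ^ k) = 1 + (x ^ ?q + poly p x)"
      using q by (simp add: p_def poly_sum poly_monom del: zero_less_card_finite)
    finally show ?thesis by (simp add: field_power_card)
  qed
  have "p = 0"
  proof (rule ccontr)
    assume "p \<noteq> 0"
    then have "?q \<le> degree p"
      using card_poly_roots_bound[of p] eval by simp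
    moreover have "degree p \<le> ?q - 1"
      by (rule degree_le) (auto simp: coeff_p)
    ultimately show False using q by linarith
  qed
  with assms coeff_p[of k] show ?thesis by simp
qed

text \<open>Both sides agree on \<open>Z\<close> and at 0, one point more than their degrees allow.
  The constant coefficient 1 fixes the factors as 1 - x / z, which suits power sums of
  inverses.\<close>

lemma poly_eq_prod_roots:
  fixes p :: "'b :: field poly"
  assumes "finite Z" "0 \<notin> Z" "coeff p 0 = 1" "degree p \<le> card Z" "\<And>z. z \<in> Z \<Longrightarrow> poly p z = 0"
  shows "p = (\<Prod>z\<in>Z. [:1, - inverse z:])"
proof (rule ccontr)
  let ?r = "\<Prod>z\<in>Z. [:1, - inverse z:]"
  assume "p \<noteq> ?r"
  then have nz: "p - ?r \<noteq> 0" by simp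
  have "poly (p - ?r) z = 0" if "z \<in> insert 0 Z" for z
  proof (cases "z = 0")
    case True
    then show ?thesis using assms(3) by (simp add: poly_prod flip: poly_0_coeff_0)
  next
    case False
    then have "poly [:1, - inverse z:] z = 0" by simp
    with False that assms show ?thesis by (auto simp: poly_prod intro!: prod_zero bexI[of _ z])
  qed
  then have "card (insert 0 Z) \<le> card {z. poly (p - ?r) z = 0}"
    by (intro card_mono poly_roots_finite nz) auto
  also have "\<dots> \<le> degree (p - ?r)" by (rule card_poly_roots_bound[OF nz])
  also have "\<dots> \<le> card Z"
  proof (rule degree_diff_le)
    have "degree ?r \<le> (\<Sum>z\<in>Z. degree [:1, - inverse z:])"
      using degree_prod_sum_le[OF \<open>finite Z\<close>, of "\<lambda>z. [:1, - inverse z:]"] by (simp only: o_def)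
    also have "\<dots> \<le> (\<Sum>z\<in>Z. 1)" by (intro sum_mono) simp
    finally show "degree ?r \<le> card Z" by simp
  qed fact
  finally show False using assms by simp
qed

text \<open>Logarithmic derivative: a factor 1 - x / z contributes -(1/z) / (1 - x / z), a geometric
  series. The form without division turns the induction on \<open>Z\<close> into the product
  rule.\<close>

lemma fps_deriv_prod_inverse_roots:
  fixes Z :: "'b :: field set"
  assumes "finite Z" "0 \<notin> Z"
  shows "fps_deriv (fps_of_poly (\<Prod>z\<in>Z. [:1, - inverse z:])) =
    - fps_of_poly (\<Prod>z\<in>Z. [:1, - inverse z:]) * Abs_fps (\<lambda>i. \<Sum>z\<in>Z. inverse z ^ Suc i)"
  using assms
proof (induction Z rule: finite_induct)
  case empty
  then show ?case by (simp add: fps_eq_iff)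
next
  case (insert b Z)
  let ?P = "fps_of_poly (\<Prod>z\<in>Z. [:1, - inverse z:])" and ?L = "fps_of_poly [:1, - inverse b:]"
  let ?S = "Abs_fps (\<lambda>i. \<Sum>z\<in>Z. inverse z ^ Suc i)" and ?B = "Abs_fps (\<lambda>i. inverse b ^ Suc i)"
  have L: "?L = 1 - fps_const (inverse b) * fps_X"
    by (simp add: fps_of_poly_pCons fps_eq_iff)
  have LB: "?L * ?B = fps_const (inverse b)"
    unfolding L by (auto simp: fps_eq_iff left_diff_distrib mult.assoc fps_mult_left_const_nth
      power_Suc[symmetric] simp del: power_Suc)
  have "fps_deriv (?L * ?P) = - fps_const (inverse b) * ?P + ?L * fps_deriv ?P"
    by (simp add: L)
  also have "fps_deriv ?P = - ?P * ?S"
    using insert by simp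
  also have "- fps_const (inverse b) * ?P + ?L * (- ?P * ?S) = - (?L * ?P) * (?B + ?S)"
    unfolding LB[symmetric] by (simp add: algebra_simps)
  also have "?B + ?S = Abs_fps (\<lambda>i. \<Sum>z\<in>insert b Z. inverse z ^ Suc i)"
    using insert by (simp add: fps_eq_iff)
  finally show ?case
    unfolding prod.insert[OF insert.hyps(1,2)] fps_of_poly_mult .
qed

lemma newton_identity_inverse_roots:
  fixes Z :: "'b :: field set"
  assumes "finite Z" "0 \<notin> Z" and p: "p = (\<Prod>z\<in>Z. [:1, - inverse z:])"
  shows "of_nat (Suc n) * coeff p (Suc n) =
    - (\<Sum>i\<le>n. (\<Sum>z\<in>Z. inverse z ^ Suc i) * coeff p (n - i))"
proof -
  have "fps_nth (fps_deriv (fps_of_poly p)) n =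
      fps_nth (- (Abs_fps (\<lambda>i. \<Sum>z\<in>Z. inverse z ^ Suc i) * fps_of_poly p)) n"
    unfolding p fps_deriv_prod_inverse_roots[OF assms(1,2)] by (simp add: mult.commute)
  then show ?thesis by (simp add: fps_mult_nth atLeast0AtMost)
qed

section \<open>Counting and scaling monic polynomials\<close>

lemma finite_degree_eq: "finite {a :: 'a :: {finite, zero} poly. P a \<and> degree a = d}"
  by (rule finite_subset[OF _ finite_degree_le[of d]]) auto

lemma card_monic_degree_eq:
  "card {a :: 'a :: {finite, field} poly. lead_coeff a = 1 \<and> degree a = d} = CARD('a) ^ d"
proof (induction d)
  case 0
  have "{a :: 'a poly. lead_coeff a = 1 \<and> degree a = 0} = {1}"
    by (auto elim!: degree_eq_zeroE)
  then show ?case by simp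
next
  case (Suc d)
  let ?M = "\<lambda>d. {a :: 'a poly. lead_coeff a = 1 \<and> degree a = d}"
  have "?M (Suc d) = (\<lambda>(c, a). pCons c a) ` (UNIV \<times> ?M d)"
  proof (intro equalityI subsetI)
    fix a assume "a \<in> ?M (Suc d)"
    then show "a \<in> (\<lambda>(c, a). pCons c a) ` (UNIV \<times> ?M d)"
      by (cases a) (auto simp: image_iff split: if_splits)
  qed (auto split: if_splits)
  moreover have "inj_on (\<lambda>(c, a). pCons c a) (UNIV \<times> ?M d)"
    by (auto simp: inj_on_def)
  ultimately show ?case using Suc by (simp add: card_image card_cartesian_product)
qed

lemma bij_betw_smult_monic:
  "bij_betw (\<lambda>(c, a). smult c a) ((UNIV - {0}) \<times> {a :: 'a :: field poly. lead_coeff a = 1 \<and> degree a < d})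
     {a. a \<noteq> 0 \<and> degree a < d}"
proof (rule bij_betwI[where g = "\<lambda>a. (lead_coeff a, smult (inverse (lead_coeff a)) a)"])
qed auto

section \<open>The embedding of polynomials and truncations of zeta sums\<close>

lemma poly_emb_smult: "poly_emb (smult c a) = fls_const c * poly_emb a"
  by (rule fls_eqI) (simp add: fls_nth_poly_emb)

lemma inj_poly_emb: "inj poly_emb"
proof (rule injI)
  fix a b :: "'a poly" assume "poly_emb a = poly_emb b"
  then have "fls_nth (poly_emb a) (- int n) = fls_nth (poly_emb b) (- int n)" for n by simp
  then show "a = b" by (simp add: fls_nth_poly_emb poly_eq_iff)
qed

lemma poly_emb_0 [simp]: "poly_emb 0 = 0"
  by (simp add: poly_emb_def)

lemma poly_emb_eq_0_iff [simp]: "poly_emb a = 0 \<longleftrightarrow> a = 0"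
  using inj_poly_emb[THEN inj_eq, of a 0] by simp

text \<open>Expansion of 1 / (1 - a x - b x^(q+1)): k counts the steps of length q + 1 among the n -
  q k steps that make up n. The bound \<open>M\<close> is there because the recurrence will be known
  only on an initial range.\<close>

lemma linear_recurrence_eq_binomial_sum:
  fixes g :: "nat \<Rightarrow> 'b :: comm_ring_1"
  assumes "g 0 = 1"
    and rec: "\<And>n. 0 < n \<Longrightarrow> n \<le> M \<Longrightarrow>
      g n = a * g (n - 1) + (if n > q then b * g (n - (q + 1)) else 0)"
    and "n \<le> M"
  shows "g n = (\<Sum>k\<le>n. of_nat ((n - q * k) choose k) * a ^ (n - (q + 1) * k) * b ^ k)"
proof -
  define t where "t = (\<lambda>n k. of_nat ((n - q * k) choose k) * a ^ (n - (q + 1) * k) * b ^ k)"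
  \<comment> \<open>Even where the natural subtractions truncate, the binomial is zero, so ranges of
    summation can be enlarged freely.\<close>
  have t0: "t n k = 0" if "n < (q + 1) * k" for n k
  proof -
    have "n - q * k < k" using that by (cases "n < q * k") (auto intro: Nat.gr0I)
    then show ?thesis by (simp add: t_def binomial_eq_0)
  qed
  \<comment> \<open>Pascal's rule: the last step has length 1 or q + 1.\<close>
  have t_rec: "t n k = a * t (n - 1) k + (if k > 0 \<and> n > q then b * t (n - (q + 1)) (k - 1) else 0)"
    if "n > 0" for n k
  proof (cases "n < (q + 1) * k")
    case True
    then show ?thesis using t0[of n k] t0[of "n - 1" k] t0[of "n - (q + 1)" "k - 1"]
      by (cases k) auto
  next
    case False
    show ?thesis
    proof (cases k)
      case 0
      with that show ?thesis by (cases n) (auto simp: t_def)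
    next
      case (Suc j)
      define m where "m = n - (q + 1) * k"
      have n: "n = m + (q + 1) * k" using False by (simp add: m_def)
      have "n - q * k = Suc (m + j)" "n - (q + 1) * k = m" "n - 1 - q * k = m + j"
        "n - 1 - (q + 1) * k = m - 1" "n - (q + 1) - q * j = m + j" "n - (q + 1) - (q + 1) * j = m"
        by (auto simp: n Suc algebra_simps)
      then show ?thesis using n
        by (cases m) (auto simp: t_def Suc algebra_simps binomial_eq_0)
    qed
  qed
  have t_sum: "(\<Sum>k\<le>m. t n k) = (\<Sum>k\<le>n. t n k)" if "n \<le> m" for m n
    by (rule sum.mono_neutral_right) (use that in \<open>auto intro!: t0\<close>)
  have "g n = (\<Sum>k\<le>n. t n k)" using \<open>n \<le> M\<close>
  proof (induction n rule: less_induct)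
    case (less n)
    show ?case
    proof (cases n)
      case 0
      then show ?thesis using assms by (simp add: t_def)
    next
      case (Suc m)
      have "(\<Sum>k\<le>n. t n k) = a * (\<Sum>k\<le>n. t m k) +
          (\<Sum>k\<le>Suc m. if k > 0 \<and> n > q then b * t (n - (q + 1)) (k - 1) else 0)"
        using t_rec[of n] by (simp add: Suc sum.distrib sum_distrib_left del: sum.atMost_Suc)
      also have "(\<Sum>k\<le>n. t m k) = g m"
        using less Suc t_sum[of m n] by simp
      also have "(\<Sum>k\<le>Suc m. if k > 0 \<and> n > q then b * t (n - (q + 1)) (k - 1) else 0) =
          (if n > q then b * (\<Sum>k\<le>m. t (n - (q + 1)) k) else 0)"
        by (subst sum.atMost_Suc_shift) (simp add: sum_distrib_left)
      also have "\<dots> = (if n > q then b * g (n - (q + 1)) else 0)"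
        using less Suc t_sum[of "n - (q + 1)" m] by simp
      finally show ?thesis using rec[of n] less.prems Suc by simp
    qed
  qed
  then show ?thesis by (simp add: t_def)
qed

lemma sum_monic_degree_less:
  fixes f :: "'a :: {finite, field} poly \<Rightarrow> 'b :: comm_monoid_add"
  shows "(\<Sum>a | lead_coeff a = 1 \<and> degree a < d. f a) =
    (\<Sum>j<d. \<Sum>a | lead_coeff a = 1 \<and> degree a = j. f a)"
proof -
  let ?S = "{a :: 'a poly. lead_coeff a = 1 \<and> degree a < d}"
  have "finite ?S" by (rule finite_subset[OF _ finite_degree_le[of d]]) auto
  then have "sum f ?S = (\<Sum>j<d. \<Sum>a | a \<in> ?S \<and> degree a = j. f a)"
    by (intro sum.group[symmetric]) auto
  also have "\<dots> = (\<Sum>j<d. \<Sum>a | lead_coeff a = 1 \<and> degree a = j. f a)"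
    by (intro sum.cong) auto
  finally show ?thesis .
qed

lemma poly_emb_add: "poly_emb (a + b) = poly_emb a + poly_emb b"
  by (rule fls_eqI) (simp add: fls_nth_poly_emb)

lemma poly_emb_diff: "poly_emb (a - b) = poly_emb a - poly_emb b"
  by (rule fls_eqI) (simp add: fls_nth_poly_emb)

lemma poly_emb_pCons: "poly_emb (pCons c a) = fls_const c + theta * poly_emb a"
  by (simp add: poly_emb_def map_poly_pCons)

lemma poly_emb_mult: "poly_emb (a * b) = poly_emb a * poly_emb b"
  by (induction a) (simp_all add: poly_emb_add poly_emb_smult poly_emb_pCons distrib_right mult.assoc)

lemma poly_emb_1 [simp]: "poly_emb 1 = 1"
  by (simp add: poly_emb_def map_poly_1)

lemma poly_emb_power: "poly_emb (a ^ n) = poly_emb a ^ n"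
  by (induction n) (simp_all add: poly_emb_mult)

lemma bracket_eq_poly_emb:
  "bracket k = poly_emb ([:0, 1:] ^ (CARD('a) ^ k) - [:0, 1 :: 'a :: {finite, field}:])"
  by (simp add: bracket_def poly_emb_diff poly_emb_power poly_emb_pCons)

section \<open>Coefficients of products and of infinite sums\<close>

lemma fls_nth_mult_eq_0:
  fixes x y :: "'a :: {comm_semiring_0, semiring_no_zero_divisors} fls"
  assumes "\<And>k. k < m \<Longrightarrow> fls_nth x k = 0" "\<And>k. k < n \<Longrightarrow> fls_nth y k = 0" "k < m + n"
  shows "fls_nth (x * y) k = 0"
proof (cases "x * y = 0")
  case False
  then have "x \<noteq> 0" "y \<noteq> 0" by auto
  with assms have "m \<le> fls_subdegree x" "n \<le> fls_subdegree y"
    by (auto intro!: fls_subdegree_geI)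
  with False assms show ?thesis
    by (intro fls_eq0_below_subdegree) (simp add: \<open>x \<noteq> 0\<close> \<open>y \<noteq> 0\<close>)
qed (simp only: fls_zero_nth)

text \<open>Two series at distance below 2^(-N) agree in all coefficients below N. So coefficient k
  of the limit can be read off a large finite partial sum, and that sum can be cut down to
  \<open>B\<close>.\<close>

lemma fls_nth_infsum:
  fixes f :: "'b \<Rightarrow> 'a :: ab_group_add fls"
  assumes "f summable_on A" "finite B" "B \<subseteq> A" "\<And>x. x \<in> A - B \<Longrightarrow> fls_nth (f x) k = 0"
  shows "fls_nth (infsum f A) k = fls_nth (sum f B) k"
proof -
  let ?S = "infsum f A" and ?N = "Suc (nat k)"
  have "(sum f \<longlongrightarrow> ?S) (finite_subsets_at_top A)"
    using has_sum_infsum[OF assms(1)] by (simp add: has_sum_def)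
  then have "\<forall>\<^sub>F Y in finite_subsets_at_top A. dist (sum f Y) ?S < inverse (2 ^ ?N)"
    by (rule tendstoD) simp
  then obtain X where "finite X \<and> X \<subseteq> A \<and>
      (\<forall>Y. finite Y \<and> X \<subseteq> Y \<and> Y \<subseteq> A \<longrightarrow> dist (sum f Y) ?S < inverse (2 ^ ?N))"
    unfolding eventually_finite_subsets_at_top by (rule exE)
  then have X: "finite X" "X \<subseteq> A"
    and dist: "\<forall>Y. finite Y \<and> X \<subseteq> Y \<and> Y \<subseteq> A \<longrightarrow> dist (sum f Y) ?S < inverse (2 ^ ?N)"
    by auto
  let ?Y = "X \<union> B"
  have "dist (sum f ?Y) ?S < inverse (2 ^ ?N)"
    using X assms(2,3) by (intro dist[rule_format]) auto
  have "fls_nth (sum f ?Y - ?S) k = 0"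
  proof (cases "sum f ?Y = ?S")
    case False
    let ?e = "fls_subdegree (sum f ?Y - ?S)"
    have "int ?N \<le> ?e"
    proof (rule ccontr)
      assume "\<not> int ?N \<le> ?e"
      then have "nat ?e \<le> ?N" by linarith
      then have "inverse (2 ^ ?N) \<le> (inverse (2 ^ nat ?e) :: real)"
        by (intro le_imp_inverse_le power_increasing) auto
      \<comment> \<open>For negative subdegree the metric takes its other branch, a power of 2 that
        is at least 1.\<close>
      moreover have "inverse (2 ^ ?N) \<le> (2 ^ nat (- ?e) :: real)"
        by (rule order.trans[of _ 1]) (auto simp: inverse_le_1_iff one_le_power simp del: power_Suc)
      ultimately show False
        using \<open>dist (sum f ?Y) ?S < inverse (2 ^ ?N)\<close> False
        by (auto simp: dist_fls_def split: if_splits)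
    qed
    then show ?thesis by (intro fls_eq0_below_subdegree) linarith
  qed simp
  then have "fls_nth ?S k = fls_nth (sum f ?Y) k" by simp
  also have "\<dots> = fls_nth (sum f B) k"
    unfolding fls_nth_sum using X assms by (intro sum.mono_neutral_right) auto
  finally show ?thesis .
qed

text \<open>A monic polynomial of degree at least n contributes only from order n s >= n > k
  onwards.\<close>

lemma fls_nth_carlitz_zeta:
  assumes "s > 0" "k < int n"
  shows "fls_nth (carlitz_zeta s) k = fls_nth (\<Sum>d<n. power_sum d s :: 'a :: {finite, field} fls) k"
proof -
  let ?B = "{a :: 'a poly. lead_coeff a = 1 \<and> degree a < n}"
  have "fls_nth (carlitz_zeta s :: 'a fls) k = fls_nth (\<Sum>a\<in>?B. poly_emb a powi (- s)) k"
    unfolding carlitz_zeta_def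
  proof (rule fls_nth_infsum[OF carlitz_zeta_summable[OF assms(1)]])
    show "finite ?B" by (rule finite_subset[OF _ finite_degree_le[of n]]) auto
    fix a :: "'a poly" assume a: "a \<in> {a. lead_coeff a = 1} - ?B"
    then have "int n * 1 \<le> int (degree a) * s"
      using assms by (intro mult_mono) auto
    moreover have "fls_subdegree (poly_emb a powi (- s)) = int (degree a) * s"
      using a by (intro fls_subdegree_poly_emb_powi) simp
    ultimately show "fls_nth (poly_emb a powi (- s)) k = 0"
      using assms by (intro fls_eq0_below_subdegree) linarith
  qed auto
  then show ?thesis by (simp add: sum_monic_degree_less power_sum_def)
qed

text \<open>Each S_d(s) has order at least d, so tuples with d1 >= n start beyond index k, and a
  finite iterated sum remains.\<close>

lemma fls_nth_multizeta_depth_3: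
  assumes "s1 > 0" "s2 > 0" "s3 > 0" "k < int n"
  shows "fls_nth (multizeta [s1, s2, s3] :: 'a :: {finite, field} fls) k =
    fls_nth (\<Sum>d1<n. power_sum d1 s1 * (\<Sum>d2<d1. power_sum d2 s2 * (\<Sum>d3<d2. power_sum d3 s3))) k"
proof -
  let ?F = "\<lambda>ds. \<Prod>i<length [s1, s2, s3]. power_sum (ds ! i) ([s1, s2, s3] ! i) :: 'a fls"
  let ?T = "SIGMA d1:{..<n}. SIGMA d2:{..<d1}. {..<d2}"
  let ?l = "\<lambda>(d1, d2, d3). [d1, d2, d3]"
  have F: "?F [d1, d2, d3] = power_sum d1 s1 * (power_sum d2 s2 * power_sum d3 s3)" for d1 d2 d3
    by (simp add: eval_nat_numeral mult.assoc)
  have nonneg: "fls_nth (power_sum d s) j = 0" if "s > 0" "j < int d" for d s j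
  proof -
    have "int d * 1 \<le> int d * s" using that by (intro mult_left_mono) auto
    then show ?thesis using that by (intro fls_nth_power_sum_eq_0) simp
  qed
  have "fls_nth (multizeta [s1, s2, s3] :: 'a fls) k = fls_nth (\<Sum>ds\<in>?l ` ?T. ?F ds) k"
    unfolding multizeta_def
  proof (rule fls_nth_infsum[OF multizeta_summable])
    fix ds assume ds: "ds \<in> {ds. length ds = length [s1, s2, s3] \<and> sorted_wrt (>) ds} - ?l ` ?T"
    then obtain d1 d2 d3 where ds_eq: "ds = [d1, d2, d3]" "d2 < d1" "d3 < d2"
      by (auto simp: length_Suc_conv)
    with ds have "\<not> d1 < n" by (auto simp: image_iff)
    then have "k < int d1 + (int d2 + int d3)" using assms by simp
    then show "fls_nth (?F ds) k = 0"
      unfolding ds_eq F by (rule fls_nth_mult_eq_0[rotated 2])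
        (use assms nonneg in \<open>auto intro: fls_nth_mult_eq_0[of "int d2" _ "int d3"]\<close>)
  qed (use assms in auto)
  also have "(\<Sum>ds\<in>?l ` ?T. ?F ds) = (\<Sum>(d1, d2, d3)\<in>?T. ?F [d1, d2, d3])"
    by (subst sum.reindex) (auto simp: inj_on_def case_prod_unfold intro!: sum.cong)
  also have "\<dots> = (\<Sum>d1<n. \<Sum>(d2, d3)\<in>(SIGMA d2:{..<d1}. {..<d2}). ?F [d1, d2, d3])"
    by (subst sum.Sigma) auto
  also have "\<dots> = (\<Sum>d1<n. \<Sum>d2<d1. \<Sum>d3<d2. ?F [d1, d2, d3])"
    by (subst sum.Sigma) auto
  finally show ?thesis
    unfolding F by (simp add: sum_distrib_left)
qed

section \<open>Carlitz polynomials and their coefficients\<close>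

context
  fixes q :: nat
  assumes q_def: "q = CARD('a :: {finite, field})"
begin

section \<open>Frobenius powers and brackets\<close>

lemma q_gt_1: "q > 1"
proof -
  have "card {0, 1 :: 'a} \<le> CARD('a)" by (rule card_mono) auto
  then show ?thesis by (simp add: q_def)
qed

lemma of_nat_q [simp]: "(of_nat q :: 'a) = 0"
  using binomial_card_field_eq_0[of 1, where 'a = 'a] q_gt_1 by (simp add: q_def)

lemma frobenius_add: "(x + y :: 'a fls) ^ q = x ^ q + y ^ q"
proof -
  have "(x + y) ^ q = (\<Sum>k\<le>q. of_nat (q choose k) * x ^ k * y ^ (q - k))"
    by (rule binomial_ring)
  also have "\<dots> = (\<Sum>k\<in>{0, q}. of_nat (q choose k) * x ^ k * y ^ (q - k))"
    by (intro sum.mono_neutral_right)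
      (auto simp: fls_of_nat q_def intro!: binomial_card_field_eq_0)
  also have "\<dots> = x ^ q + y ^ q"
    using q_gt_1 by simp
  finally show ?thesis .
qed

lemma frobenius_minus: "(- x :: 'a fls) ^ q = - (x ^ q)"
  using frobenius_add[of x "- x"] q_gt_1
  by (simp add: eq_neg_iff_add_eq_0 add.commute power_0_left)

lemma frobenius_diff: "(x - y :: 'a fls) ^ q = x ^ q - y ^ q"
  using frobenius_add[of x "- y"] by (simp add: frobenius_minus)

lemma frobenius_sum: "(\<Sum>x\<in>A. f x :: 'a fls) ^ q = (\<Sum>x\<in>A. f x ^ q)"
  using q_gt_1 by (induction A rule: infinite_finite_induct) (auto simp: frobenius_add)

lemma frobenius_power_add: "(x + y :: 'a fls) ^ q ^ k = x ^ q ^ k + y ^ q ^ k"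
  by (induction k) (auto simp: power_mult frobenius_add power_Suc2 simp del: power_Suc)

lemma frobenius_power_diff: "(x - y :: 'a fls) ^ q ^ k = x ^ q ^ k - y ^ q ^ k"
  by (induction k) (auto simp: power_mult frobenius_diff power_Suc2 simp del: power_Suc)

lemma frobenius_power_minus: "(- x :: 'a fls) ^ q ^ k = - (x ^ q ^ k)"
  using frobenius_power_diff[of 0 x k] q_gt_1 by simp

lemma frobenius_power_sum: "(\<Sum>x\<in>A. f x :: 'a fls) ^ q ^ k = (\<Sum>x\<in>A. f x ^ q ^ k)"
  using q_gt_1 by (induction A rule: infinite_finite_induct) (auto simp: frobenius_power_add)

lemma fls_const_power_q: "fls_const (c :: 'a) ^ q = fls_const c"
  by (simp add: q_def field_power_card flip: fls_const_power)

lemma fls_const_power_q_power: "fls_const (c :: 'a) ^ q ^ k = fls_const c"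
  by (induction k) (auto simp: power_mult fls_const_power_q power_Suc2 simp del: power_Suc)

lemma bracket_altdef: "bracket k = theta ^ q ^ k - (theta :: 'a fls)"
  by (simp add: bracket_def q_def)

lemma bracket_0 [simp]: "bracket 0 = (0 :: 'a fls)"
  by (simp add: bracket_altdef)

lemma bracket_frobenius: "bracket k ^ q ^ j = bracket (k + j) - (bracket j :: 'a fls)"
  by (simp add: bracket_altdef frobenius_power_diff power_add mult.commute flip: power_mult)

lemma bracket_power_q: "bracket k ^ q = bracket (Suc k) - (bracket 1 :: 'a fls)"
  using bracket_frobenius[of k 1] by simp

lemma bracket_nonzero: "k > 0 \<Longrightarrow> bracket k \<noteq> (0 :: 'a fls)"
proof
  assume "k > 0" "bracket k = (0 :: 'a fls)"
  then have "fls_subdegree (theta ^ q ^ k :: 'a fls) = fls_subdegree (theta :: 'a fls)"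
    by (simp add: bracket_altdef)
  then have "int (q ^ k) = int 1" by (simp add: theta_def fls_subdegree_pow)
  then have "q ^ k = 1" by (simp only: of_nat_eq_iff)
  with \<open>k > 0\<close> q_gt_1 show False by simp
qed

text \<open>The coefficient of x^(q^i) in E_d: the q-th power of E_d shifts i by one and raises the
  coefficients to the power q. In Carlitz's notation \<open>carlitz_coeff d 0\<close> is 1 / l_d,
  with l_d the product of \<theta> - \<theta>^(q^i) for i = 1, ..., d.\<close>

primrec carlitz_coeff :: "nat \<Rightarrow> nat \<Rightarrow> 'a fls" where
  "carlitz_coeff 0 i = (if i = 0 then 1 else 0)"
| "carlitz_coeff (Suc d) i =
     ((if i = 0 then 0 else carlitz_coeff d (i - 1) ^ q) - carlitz_coeff d i) / bracket (Suc d)"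

definition carlitz_poly :: "nat \<Rightarrow> 'a fls poly" where
  "carlitz_poly d = (\<Sum>i\<le>d. monom (carlitz_coeff d i) (q ^ i))"

lemma carlitz_coeff_eq_0: "i > d \<Longrightarrow> carlitz_coeff d i = 0"
  using q_gt_1 by (induction d arbitrary: i) (auto simp: power_0_left)

lemma carlitz_poly_eval: "poly (carlitz_poly d) x = (\<Sum>i\<le>d. carlitz_coeff d i * x ^ q ^ i)"
  by (simp add: carlitz_poly_def poly_sum poly_monom)

lemma carlitz_poly_0: "poly (carlitz_poly 0) x = x"
  by (simp add: carlitz_poly_eval)

lemma carlitz_poly_Suc:
  "bracket (Suc d) * poly (carlitz_poly (Suc d)) x =
     poly (carlitz_poly d) x ^ q - poly (carlitz_poly d) x"
proof -
  let ?c = carlitz_coeff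
  have "bracket (Suc d) * poly (carlitz_poly (Suc d)) x =
      (\<Sum>i\<le>Suc d. (if i = 0 then 0 else ?c d (i - 1) ^ q) * x ^ q ^ i) -
      (\<Sum>i\<le>Suc d. ?c d i * x ^ q ^ i)"
    unfolding carlitz_poly_eval sum_distrib_left sum_subtractf[symmetric]
    by (intro sum.cong refl) (simp add: bracket_nonzero left_diff_distrib)
  also have "(\<Sum>i\<le>Suc d. (if i = 0 then 0 else ?c d (i - 1) ^ q) * x ^ q ^ i) =
      (\<Sum>i\<le>d. ?c d i ^ q * x ^ q ^ Suc i)"
    by (subst sum.atMost_Suc_shift) simp
  also have "\<dots> = poly (carlitz_poly d) x ^ q"
    by (simp add: carlitz_poly_eval frobenius_sum power_mult_distrib mult.commute flip: power_mult)
  also have "(\<Sum>i\<le>Suc d. ?c d i * x ^ q ^ i) = poly (carlitz_poly d) x"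
    by (simp add: carlitz_poly_eval carlitz_coeff_eq_0)
  finally show ?thesis .
qed

lemma carlitz_poly_add:
  "poly (carlitz_poly d) (x + y) = poly (carlitz_poly d) x + poly (carlitz_poly d) y"
  by (simp add: carlitz_poly_eval frobenius_power_add distrib_left sum.distrib)

lemma carlitz_poly_const:
  "poly (carlitz_poly d) (fls_const c) = fls_const c * poly (carlitz_poly d) 1"
  by (simp add: carlitz_poly_eval fls_const_power_q_power sum_distrib_left sum_distrib_right mult.commute)

lemma carlitz_poly_at_1: "d > 0 \<Longrightarrow> poly (carlitz_poly d) 1 = 0"
proof (induction d)
  case (Suc d)
  have "bracket (Suc d) * poly (carlitz_poly (Suc d)) 1 = 0"
    unfolding carlitz_poly_Suc using Suc.IH q_gt_1 by (cases "d = 0") (auto simp: carlitz_poly_0)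
  then show ?case by (simp add: bracket_nonzero)
qed auto

text \<open>This rule allows induction along the coefficients of a polynomial argument, in the
  manner of Horner.\<close>

lemma carlitz_poly_theta_mult:
  "poly (carlitz_poly (Suc d)) (theta * x) =
     theta * poly (carlitz_poly (Suc d)) x + poly (carlitz_poly d) x ^ q"
proof (induction d)
  case 0
  have "bracket 1 * poly (carlitz_poly 1) (theta * x) =
      bracket 1 * (theta * poly (carlitz_poly 1) x + x ^ q)"
    unfolding distrib_left mult.left_commute[of _ theta] One_nat_def carlitz_poly_Suc carlitz_poly_0
    by (simp add: bracket_altdef power_mult_distrib algebra_simps)
  then show ?case by (simp add: bracket_nonzero carlitz_poly_0)
next
  case (Suc d)
  let ?E = "\<lambda>d. poly (carlitz_poly d) x"
  have "bracket (Suc (Suc d)) * poly (carlitz_poly (Suc (Suc d))) (theta * x) =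
      (theta * ?E (Suc d) + ?E d ^ q) ^ q - (theta * ?E (Suc d) + ?E d ^ q)"
    by (simp only: carlitz_poly_Suc Suc.IH)
  also have "\<dots> = theta ^ q * ?E (Suc d) ^ q - theta * ?E (Suc d) + (?E d ^ q - ?E d) ^ q"
    by (simp add: frobenius_add frobenius_diff power_mult_distrib)
  \<comment> \<open>Here [d + 1]^q = [d + 2] - [1], and the part -[1] turns \<theta>^q into \<theta>
    in front of the q-th power of E_(d+1).\<close>
  also have "(?E d ^ q - ?E d) ^ q = (bracket (Suc (Suc d)) - bracket 1) * ?E (Suc d) ^ q"
    by (simp only: carlitz_poly_Suc[symmetric] power_mult_distrib bracket_power_q)
  also have "theta ^ q * ?E (Suc d) ^ q - theta * ?E (Suc d) + \<dots> =
      theta * (?E (Suc d) ^ q - ?E (Suc d)) + bracket (Suc (Suc d)) * ?E (Suc d) ^ q"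
    by (simp add: bracket_altdef[of "Suc 0"] algebra_simps)
  also have "\<dots> = bracket (Suc (Suc d)) * (theta * ?E (Suc (Suc d)) + ?E (Suc d) ^ q)"
    by (simp only: carlitz_poly_Suc[symmetric] algebra_simps)
  finally show ?case by (simp add: bracket_nonzero)
qed

text \<open>As E_d(1) = 0 for d > 0, the value at c + \<theta> a is \<theta> E_d(a) + E_(d-1)(a)^q.
  Both claims are proved together and for all d, since the step uses a at d and at d - 1.\<close>

lemma carlitz_poly_poly_emb:
  "(degree a < d \<longrightarrow> poly (carlitz_poly d) (poly_emb a) = 0) \<and>
   (degree a = d \<longrightarrow> poly (carlitz_poly d) (poly_emb a) = fls_const (lead_coeff a))"
proof (induction a arbitrary: d)
  case 0
  then show ?case using q_gt_1 by (simp add: carlitz_poly_eval poly_emb_def power_0_left)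
next
  case (pCons c a)
  show ?case
  proof (cases d)
    case 0
    show ?thesis
      by (auto simp: 0 carlitz_poly_0 poly_emb_pCons split: if_splits)
  next
    case (Suc e)
    have "poly (carlitz_poly d) (poly_emb (pCons c a)) =
        theta * poly (carlitz_poly d) (poly_emb a) + poly (carlitz_poly e) (poly_emb a) ^ q"
      by (simp add: Suc poly_emb_pCons carlitz_poly_add carlitz_poly_theta_mult carlitz_poly_const
        carlitz_poly_at_1)
    moreover have "poly (carlitz_poly d) 0 = 0" for d
      using q_gt_1 by (simp add: carlitz_poly_eval power_0_left)
    ultimately show ?thesis
      using pCons.IH[of d] pCons.IH[of e] pCons.hyps q_gt_1
      by (cases "a = 0") (auto simp: Suc fls_const_power_q poly_emb_def)
  qed
qed

lemma carlitz_poly_poly_emb_eq_0: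
  "degree a < d \<Longrightarrow> poly (carlitz_poly d) (poly_emb a) = 0"
  using carlitz_poly_poly_emb by blast

lemma carlitz_poly_poly_emb_monic:
  "degree a = d \<Longrightarrow> lead_coeff a = 1 \<Longrightarrow> poly (carlitz_poly d) (poly_emb a) = 1"
  using carlitz_poly_poly_emb[of a d] by simp

lemma coeff_carlitz_poly_power: "coeff (carlitz_poly d) (q ^ i) = carlitz_coeff d i"
  using q_gt_1 by (simp add: carlitz_poly_def coeff_sum carlitz_coeff_eq_0)

lemma coeff_carlitz_poly_eq_0: "n \<notin> range (\<lambda>i. q ^ i) \<Longrightarrow> coeff (carlitz_poly d) n = 0"
  by (auto simp: carlitz_poly_def coeff_sum intro!: sum.neutral)

lemma degree_carlitz_poly: "degree (carlitz_poly d) \<le> q ^ d"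
  unfolding carlitz_poly_def using q_gt_1
  by (intro degree_sum_le) (auto intro!: order.trans[OF degree_monom_le] power_increasing)


lemma coeff_carlitz_poly_0: "coeff (carlitz_poly d) 0 = 0"
  using q_gt_1 by (intro coeff_carlitz_poly_eq_0) auto

lemma carlitz_coeff_0_nonzero: "carlitz_coeff d 0 \<noteq> 0"
  by (induction d) (auto simp: bracket_nonzero)

lemma carlitz_coeff_0_Suc: "carlitz_coeff (Suc d) 0 * bracket (Suc d) = - carlitz_coeff d 0"
  by (simp add: bracket_nonzero)

text \<open>By [d]^q = [d + 1] - [1] the recursion collapses to a multiple of c_d^q, where c_d is
  \<open>carlitz_coeff d 0\<close>; this equals -(c_(d+1) [d + 1])^q. The factor [d] makes the
  formula hold at d = 0 too.\<close>

lemma carlitz_coeff_1: "bracket 1 * carlitz_coeff d 1 = - ((carlitz_coeff d 0 * bracket d) ^ q)"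
proof (induction d)
  case 0
  then show ?case using q_gt_1 by (simp add: power_0_left)
next
  case (Suc d)
  have "carlitz_coeff (Suc d) 1 * bracket (Suc d) = carlitz_coeff d 0 ^ q - carlitz_coeff d 1"
    by (simp add: bracket_nonzero)
  then have "bracket (Suc d) * (bracket 1 * carlitz_coeff (Suc d) 1) =
      bracket 1 * carlitz_coeff d 0 ^ q - bracket 1 * carlitz_coeff d 1"
    by (simp only: right_diff_distrib[symmetric]) (simp only: mult_ac)
  also have "\<dots> = bracket (Suc d) * carlitz_coeff d 0 ^ q"
    unfolding Suc by (simp add: power_mult_distrib bracket_power_q algebra_simps)
  finally have "bracket 1 * carlitz_coeff (Suc d) 1 = carlitz_coeff d 0 ^ q"
    by (simp add: bracket_nonzero)
  then show ?case by (simp only: carlitz_coeff_0_Suc frobenius_minus minus_minus)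
qed

text \<open>The same collapse one level up, with the terms in [2] cancelling. For d > 0 the last
  factor is [d - 1]^(q^2); as a difference of brackets it needs no predecessor of d.\<close>

lemma carlitz_coeff_2:
  "bracket 2 * bracket 1 ^ q * carlitz_coeff d 2 =
     (carlitz_coeff d 0 * bracket d) ^ q ^ 2 * (bracket (Suc d) - bracket 2)"
proof (induction d)
  case 0
  then show ?case using q_gt_1 by (simp add: power_0_left)
next
  case (Suc d)
  have rec: "carlitz_coeff (Suc d) 2 * bracket (Suc d) = carlitz_coeff d 1 ^ q - carlitz_coeff d 2"
    by (simp add: bracket_nonzero)
  have "bracket (Suc d) * (bracket 2 * bracket 1 ^ q * carlitz_coeff (Suc d) 2) =
      bracket 2 * bracket 1 ^ q * (carlitz_coeff d 1 ^ q - carlitz_coeff d 2)"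
    unfolding rec[symmetric] by (simp only: mult_ac)
  also have "\<dots> = bracket 2 * (bracket 1 * carlitz_coeff d 1) ^ q -
      bracket 2 * bracket 1 ^ q * carlitz_coeff d 2"
    by (simp add: power_mult_distrib algebra_simps)
  also have "\<dots> = bracket (Suc d) * - ((carlitz_coeff d 0 * bracket d) ^ q ^ 2)"
    unfolding Suc carlitz_coeff_1 frobenius_minus
    by (simp add: power2_eq_square power_mult algebra_simps)
  finally have "bracket 2 * bracket 1 ^ q * carlitz_coeff (Suc d) 2 =
      - ((carlitz_coeff d 0 * bracket d) ^ q ^ 2)"
    by (subst (asm) mult_cancel_left) (simp add: bracket_nonzero)
  also have "\<dots> = (- carlitz_coeff d 0) ^ q ^ 2 * bracket d ^ q ^ 2"
    by (simp only: frobenius_power_minus power_mult_distrib mult_minus_left)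
  finally show ?case
    by (simp only: carlitz_coeff_0_Suc bracket_frobenius) simp
qed

section \<open>Closed forms of power sums and truncated zeta values\<close>

lemma power_sum_altdef:
  "power_sum d (int k) = (\<Sum>a | lead_coeff a = 1 \<and> degree a = d. inverse (poly_emb a :: 'a fls) ^ k)"
  by (simp add: power_sum_def power_int_minus power_inverse)

lemma power_sum_frobenius: "power_sum d (int (k * q ^ j)) = (power_sum d (int k) :: 'a fls) ^ q ^ j"
  unfolding power_sum_altdef frobenius_power_sum by (simp add: power_mult)

text \<open>The q^d monic polynomials of degree d are zeros of 1 - E_d, as many as the degree
  permits.\<close>

lemma one_minus_carlitz_poly_eq_prod:
  "1 - carlitz_poly d = (\<Prod>z\<in>poly_emb ` {a. lead_coeff a = 1 \<and> degree a = d}. [:1, - inverse z:])"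
proof (rule poly_eq_prod_roots)
  let ?M = "{a :: 'a poly. lead_coeff a = 1 \<and> degree a = d}"
  have "card (poly_emb ` ?M) = q ^ d"
    by (simp add: card_image inj_on_subset[OF inj_poly_emb] card_monic_degree_eq q_def)
  moreover have "degree (1 - carlitz_poly d) \<le> q ^ d"
    by (rule degree_diff_le) (simp_all add: degree_carlitz_poly)
  ultimately show "degree (1 - carlitz_poly d) \<le> card (poly_emb ` ?M)" by simp
  show "finite (poly_emb ` ?M)" by (intro finite_imageI finite_degree_eq)
qed (auto simp: coeff_carlitz_poly_0 carlitz_poly_poly_emb_monic)

text \<open>Below x^q only the coefficients of 1 and x in 1 - E_d are nonzero, so Newton's
  identities reduce to S_d(k + 1) = c S_d(k).\<close>

lemma power_sum_small:
  assumes "0 < k" "k \<le> q"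
  shows "power_sum d (int k) = carlitz_coeff d 0 ^ k"
proof -
  let ?Z = "poly_emb ` {a :: 'a poly. lead_coeff a = 1 \<and> degree a = d}"
  let ?p = "1 - carlitz_poly d"
  have sum_Z: "(\<Sum>z\<in>?Z. inverse z ^ k) = power_sum d (int k)" for k
    by (simp add: power_sum_altdef sum.reindex inj_on_subset[OF inj_poly_emb])
  have Z: "finite ?Z" "0 \<notin> ?Z" by (auto intro!: finite_imageI finite_degree_eq)
  have coeff1: "coeff ?p 1 = - carlitz_coeff d 0"
    using coeff_carlitz_poly_power[of d 0] by simp
  have coeff_p: "coeff ?p n = 0" if "1 < n" "n < q" for n
  proof -
    have "q ^ 0 < n" "n < q ^ 1" using that by auto
    then have "n \<noteq> q ^ i" for i
      using q_gt_1 power_less_imp_less_exp[of q 0 i] power_less_imp_less_exp[of q i 1] by auto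
    then show ?thesis using that by (simp add: coeff_carlitz_poly_eq_0 image_iff coeff_1)
  qed
  note newton = newton_identity_inverse_roots[OF Z one_minus_carlitz_poly_eq_prod, unfolded sum_Z]
  show ?thesis using assms
  proof (induction k rule: nat_induct_non_zero)
    case 1
    show ?case using newton[of 0] coeff1 by (simp add: coeff_carlitz_poly_0)
  next
    case (Suc k)
    have "of_nat (Suc k) * coeff ?p (Suc k) = 0"
    \<comment> \<open>At k + 1 = q the coefficient of x^q may be nonzero, but Newton's identity
      multiplies it by q = 0.\<close>
    proof (cases "Suc k = q")
      case True
      have "of_nat q = (0 :: 'a fls)" by (simp add: fls_of_nat)
      with True show ?thesis by simp
    qed (use Suc coeff_p[of "Suc k"] in simp)
    moreover have "(\<Sum>i\<le>k. power_sum d (int (Suc i)) * coeff ?p (k - i)) =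
        (\<Sum>i\<in>{k, k - 1}. power_sum d (int (Suc i)) * coeff ?p (k - i))"
    proof (intro sum.mono_neutral_right ballI)
      fix i assume "i \<in> {..k} - {k, k - 1}"
      then have "coeff ?p (k - i) = 0" using Suc by (intro coeff_p) auto
      then show "power_sum d (int (Suc i)) * coeff ?p (k - i) = 0" by simp
    qed auto
    moreover have "\<dots> = power_sum d (int (Suc k)) - carlitz_coeff d 0 * power_sum d (int k)"
      using Suc coeff1 by (cases k) (auto simp: coeff_carlitz_poly_0 mult_ac)
    moreover have "(\<Sum>i\<le>k. power_sum d (int (Suc i)) * coeff ?p (k - i)) = 0"
      using newton[of k] calculation(1) by simp
    ultimately have "power_sum d (int (Suc k)) - carlitz_coeff d 0 * power_sum d (int k) = 0"
      by (simp only:)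
    then show ?case using Suc by simp
  qed
qed

section \<open>The truncated zeta value at q^3 - q^2 + q - 1\<close>

lemma binomial_mult_q_eq_0:
  assumes "0 < j" "j < q"
  shows "(of_nat ((q * M) choose j) :: 'a) = 0"
  using assms
proof (induction M)
  case (Suc M)
  have "(of_nat ((q * Suc M) choose j) :: 'a) =
      (\<Sum>i\<le>j. of_nat (q choose i) * of_nat ((q * M) choose (j - i)))"
    by (simp add: vandermonde[symmetric])
  also have "\<dots> = (\<Sum>i\<in>{0}. of_nat (q choose i) * of_nat ((q * M) choose (j - i)))"
    using Suc.prems
    by (intro sum.mono_neutral_right) (auto simp: q_def binomial_card_field_eq_0)
  finally show ?case using Suc by simp
qed (auto simp: binomial_eq_0)

text \<open>In the binomial sum only k = 0 and k = 1 survive in characteristic p.\<close>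

lemma recurrence_at_q_square_plus_1:
  fixes g :: "nat \<Rightarrow> 'a fls"
  assumes "g 0 = 1"
    and "\<And>n. 0 < n \<Longrightarrow> n \<le> q ^ 2 + 1 \<Longrightarrow>
      g n = a * g (n - 1) + (if n > q then b * g (n - (q + 1)) else 0)"
  shows "g (q ^ 2 + 1) = a ^ (q ^ 2 - q) * (a ^ (q + 1) + b)"
proof -
  let ?n = "q ^ 2 + 1"
  have choose_0: "of_nat ((?n - q * k) choose k) = (0 :: 'a fls)" if "k > 1" for k
  proof (cases "k < q")
    case True
    \<comment> \<open>Pascal's rule leaves two binomials over the multiple q (q - k) of q, with
      lower entries k and k - 1 strictly between 0 and q.\<close>
    then have "?n - q * k = Suc (q * (q - k))"
      by (simp add: power2_eq_square right_diff_distrib' Suc_diff_le)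
    moreover from that obtain j where "k = Suc j" "j > 0" by (auto simp: gr0_conv_Suc dest!: less_imp_Suc_add)
    ultimately show ?thesis
      using True by (simp add: fls_of_nat binomial_mult_q_eq_0)
  next
    case False
    then have "q ^ 2 \<le> q * k" by (simp add: power2_eq_square)
    then have "?n - q * k \<le> 1" by linarith
    then show ?thesis using that by (simp add: binomial_eq_0)
  qed
  have "g ?n = (\<Sum>k\<le>?n. of_nat ((?n - q * k) choose k) * a ^ (?n - (q + 1) * k) * b ^ k)"
    by (rule linear_recurrence_eq_binomial_sum[where M = ?n]) (use assms in auto)
  also have "\<dots> = (\<Sum>k\<in>{0, 1}. of_nat ((?n - q * k) choose k) * a ^ (?n - (q + 1) * k) * b ^ k)"
  proof (intro sum.mono_neutral_right ballI)
    fix k assume "k \<in> {..?n} - {0, 1}"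
    then have "k > 1" by auto
    then show "of_nat ((?n - q * k) choose k) * a ^ (?n - (q + 1) * k) * b ^ k = 0"
      by (simp only: choose_0 mult_zero_left)
  qed auto
  also have "\<dots> = a ^ ?n + of_nat (?n - q) * a ^ (?n - (q + 1)) * b"
    by simp
  also have "of_nat (?n - q) = (1 :: 'a fls)"
  proof -
    have "?n - q = q * (q - 1) + 1"
      using q_gt_1 by (simp add: power2_eq_square diff_mult_distrib2 Suc_diff_le)
    then show ?thesis by (simp add: fls_of_nat)
  qed
  also have "a ^ ?n = a ^ (q ^ 2 - q) * a ^ (q + 1)"
    using q_gt_1 by (simp add: power2_eq_square flip: power_add power_Suc)
  finally show ?thesis by (simp add: algebra_simps)
qed

text \<open>Nonzero polynomials are the unit multiples of monic ones. Units drop out because the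
  exponent is divisible by q - 1, and their number q - 1 is -1 in the field.\<close>

lemma sum_nonzero_degree_less_inverse_power:
  "(\<Sum>a | a \<noteq> 0 \<and> degree a < d. inverse (poly_emb a :: 'a fls) ^ ((q - 1) * n)) =
     - (\<Sum>j<d. power_sum j (int ((q - 1) * n)))"
proof -
  let ?M = "{a :: 'a poly. lead_coeff a = 1 \<and> degree a < d}"
  let ?k = "(q - 1) * n"
  have const: "fls_const c ^ ?k = 1" if "c \<noteq> 0" for c :: 'a
    using field_power_card_minus_1[OF that] by (simp add: power_mult q_def flip: fls_const_power)
  have "(\<Sum>a | a \<noteq> 0 \<and> degree a < d. inverse (poly_emb a :: 'a fls) ^ ?k) =
      (\<Sum>(c, a)\<in>(UNIV - {0}) \<times> ?M. inverse (poly_emb (smult c a)) ^ ?k)"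
    by (subst sum.reindex_bij_betw[OF bij_betw_smult_monic, symmetric]) (simp add: case_prod_unfold)
  also have "\<dots> = (\<Sum>(c, a)\<in>(UNIV - {0 :: 'a}) \<times> ?M. inverse (poly_emb a) ^ ?k)"
  proof (intro sum.cong refl)
    fix x assume "x \<in> (UNIV - {0 :: 'a}) \<times> ?M"
    then obtain c a where x: "x = (c, a)" "c \<noteq> 0" by auto
    with const[of c] show "(case x of (c, a) \<Rightarrow> inverse (poly_emb (smult c a)) ^ ?k) =
        (case x of (c, a) \<Rightarrow> inverse (poly_emb a) ^ ?k)"
      by (simp add: poly_emb_smult power_mult_distrib power_inverse)
  qed
  also have "\<dots> = of_nat (q - 1) * (\<Sum>a\<in>?M. inverse (poly_emb a) ^ ?k)"
    by (simp add: sum.cartesian_product[symmetric] q_def card_Diff_singleton)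
  also have "of_nat (q - 1) = (-1 :: 'a fls)"
    using q_gt_1 by (simp add: of_nat_diff fls_of_nat)
  finally show ?thesis unfolding power_sum_altdef sum_monic_degree_less by simp
qed

lemma card_nonzero_degree_less: "card {a :: 'a poly. a \<noteq> 0 \<and> degree a < d} = q ^ d - 1"
proof -
  have "card {a :: 'a poly. lead_coeff a = 1 \<and> degree a < d} = (\<Sum>j<d. q ^ j)"
    unfolding card_eq_sum sum_monic_degree_less
    by (simp add: card_monic_degree_eq q_def flip: card_eq_sum)
  then have "card {a :: 'a poly. a \<noteq> 0 \<and> degree a < d} = (q - 1) * (\<Sum>j<d. q ^ j)"
    using bij_betw_same_card[OF bij_betw_smult_monic[of d, where 'a = 'a]]
    by (simp add: card_cartesian_product card_Diff_singleton q_def)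
  moreover have "(q - 1) * (\<Sum>j<d. q ^ j) + 1 = q ^ d"
  proof (induction d)
    case (Suc d)
    have "(q - 1) * (\<Sum>j<Suc d. q ^ j) + 1 = q ^ d + (q - 1) * q ^ d"
      using Suc by (simp add: distrib_left)
    also have "\<dots> = q ^ Suc d" using q_gt_1 by (cases q) auto
    finally show ?case .
  qed simp
  ultimately show ?thesis by simp
qed

text \<open>This is E_d / (c x): \<open>poly_shift 1\<close> drops the constant coefficient of E_d,
  which is 0, and the scaling makes the new one 1.\<close>

definition reduced_carlitz_poly :: "nat \<Rightarrow> 'a fls poly" where
  "reduced_carlitz_poly d = smult (inverse (carlitz_coeff d 0)) (poly_shift 1 (carlitz_poly d))"

lemma coeff_reduced_carlitz_poly:
  "coeff (reduced_carlitz_poly d) n = coeff (carlitz_poly d) (Suc n) / carlitz_coeff d 0"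
  by (simp add: reduced_carlitz_poly_def coeff_poly_shift divide_inverse mult.commute)

lemma reduced_carlitz_poly_eq_prod:
  "reduced_carlitz_poly d = (\<Prod>z\<in>poly_emb ` {a. a \<noteq> 0 \<and> degree a < d}. [:1, - inverse z:])"
proof (rule poly_eq_prod_roots)
  let ?M = "{a :: 'a poly. a \<noteq> 0 \<and> degree a < d}"
  have "card (poly_emb ` ?M) = q ^ d - 1"
    by (simp add: card_image inj_on_subset[OF inj_poly_emb] card_nonzero_degree_less)
  moreover have "degree (reduced_carlitz_poly d) \<le> q ^ d - 1"
  proof (rule degree_le, intro allI impI)
    fix n assume "q ^ d - 1 < n"
    then have "degree (carlitz_poly d) < Suc n" using degree_carlitz_poly[of d] by simp
    then show "coeff (reduced_carlitz_poly d) n = 0"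
      by (simp add: coeff_reduced_carlitz_poly coeff_eq_0)
  qed
  ultimately show "degree (reduced_carlitz_poly d) \<le> card (poly_emb ` ?M)" by simp
  show "finite (poly_emb ` ?M)"
    by (intro finite_imageI finite_subset[OF _ finite_degree_le[of d]]) auto
  show "coeff (reduced_carlitz_poly d) 0 = 1"
    using coeff_carlitz_poly_power[of d 0] carlitz_coeff_0_nonzero
    by (simp add: coeff_reduced_carlitz_poly)
  fix z :: "'a fls" assume "z \<in> poly_emb ` ?M"
  then have "z \<noteq> 0" "poly (carlitz_poly d) z = 0" by (auto simp: carlitz_poly_poly_emb_eq_0)
  moreover have "carlitz_poly d = pCons 0 (poly_shift 1 (carlitz_poly d))"
    by (rule poly_eqI) (auto simp: coeff_pCons coeff_poly_shift coeff_carlitz_poly_0 split: nat.splits)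
  ultimately have "poly (poly_shift 1 (carlitz_poly d)) z = 0"
    by (metis add_0 mult_eq_0_iff poly_pCons)
  then show "poly (reduced_carlitz_poly d) z = 0"
    by (simp add: reduced_carlitz_poly_def)
qed auto

text \<open>Newton's identities carry a factor m, but a nonzero coefficient at m > 0 forces m + 1 to
  be a power of q, hence m = -1 in the field. With \<open>h 0 = 1\<close> this is a plain
  convolution: \<open>h\<close> is the reciprocal power series of
  \<open>reduced_carlitz_poly d\<close>.\<close>

lemma truncated_zeta_convolution:
  fixes d m :: nat
  assumes "m > 0"
  defines "h \<equiv> \<lambda>k. if k = 0 then 1 else
    - (\<Sum>a | a \<noteq> 0 \<and> degree a < d. inverse (poly_emb a :: 'a fls) ^ k)"
  shows "(\<Sum>j\<le>m. h (m - j) * coeff (reduced_carlitz_poly d) j) = 0"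
proof -
  let ?Z = "poly_emb ` {a :: 'a poly. a \<noteq> 0 \<and> degree a < d}"
  let ?P = "coeff (reduced_carlitz_poly d)"
  obtain n where m: "m = Suc n" using assms by (cases m) auto
  have Z: "finite ?Z" "0 \<notin> ?Z"
    by (auto intro!: finite_imageI finite_subset[OF _ finite_degree_le[of d]])
  have sum_Z: "(\<Sum>z\<in>?Z. inverse z ^ Suc i) = - h (Suc i)" for i
    by (simp add: h_def sum.reindex inj_on_subset[OF inj_poly_emb])
  have "of_nat m * ?P m = - ?P m"
  proof (cases "Suc m \<in> range (\<lambda>i. q ^ i)")
    case True
    then obtain i where i: "Suc m = q ^ i" by auto
    then have "i > 0" using m by (cases i) auto
    then have "of_nat (Suc m) = (0 :: 'a fls)"
      unfolding i by (simp add: fls_of_nat)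
    then have "of_nat m = (-1 :: 'a fls)" by (simp add: eq_neg_iff_add_eq_0 add.commute)
    then show ?thesis by simp
  qed (simp add: coeff_reduced_carlitz_poly coeff_carlitz_poly_eq_0)
  then have "- ?P m = (\<Sum>i\<le>n. h (Suc i) * ?P (n - i))"
    using newton_identity_inverse_roots[OF Z reduced_carlitz_poly_eq_prod, of n] m
    unfolding sum_Z by (simp add: sum_negf)
  then have "h 0 * ?P (m - 0) + (\<Sum>i\<le>n. h (Suc i) * ?P (m - Suc i)) = 0"
    by (simp add: m h_def flip: neg_eq_iff_add_eq_0)
  then have "0 = (\<Sum>k\<le>m. h k * ?P (m - k))"
    unfolding m by (subst sum.atMost_Suc_shift) (rule sym)
  also have "(\<Sum>k\<le>m. h k * ?P (m - k)) = (\<Sum>j\<le>m. h (m - j) * ?P j)"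
    by (rule sum.reindex_bij_witness[of _ "\<lambda>j. m - j" "\<lambda>j. m - j"]) auto
  finally show ?thesis by simp
qed

text \<open>Since q^2 - 1 = (q - 1)(q + 1), the convolution restricted to multiples of q - 1 is a
  recurrence with steps 1 and q + 1.\<close>

lemma truncated_zeta_eq_coeff_ratio:
  fixes d :: nat
  defines "a \<equiv> - (carlitz_coeff d 1 / carlitz_coeff d 0)"
    and "b \<equiv> - (carlitz_coeff d 2 / carlitz_coeff d 0)"
  shows "(\<Sum>j<d. power_sum j (int ((q - 1) * (q ^ 2 + 1)))) = a ^ (q ^ 2 - q) * (a ^ (q + 1) + b)"
proof -
  define h where "h = (\<lambda>k. if k = 0 then 1 else
    - (\<Sum>a | a \<noteq> 0 \<and> degree a < d. inverse (poly_emb a :: 'a fls) ^ k))"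
  define g where "g = (\<lambda>n. h ((q - 1) * n))"
  let ?P = "coeff (reduced_carlitz_poly d)"
  have P: "?P 0 = 1" "?P (q - 1) = - a" "?P (q ^ 2 - 1) = - b"
    using coeff_carlitz_poly_power[of d 0] coeff_carlitz_poly_power[of d 1]
      coeff_carlitz_poly_power[of d 2] carlitz_coeff_0_nonzero[of d] q_gt_1
    by (auto simp: coeff_reduced_carlitz_poly a_def b_def)
  have g_rec: "g n = a * g (n - 1) + (if n > q then b * g (n - (q + 1)) else 0)"
    if n: "0 < n" "n \<le> q ^ 2 + 1" for n
  proof -
    define m where "m = (q - 1) * n"
    \<comment> \<open>The exponents stay below q^3 - 1, the index of the next coefficient that could
      be nonzero.\<close>
    have cube: "(q - 1) * (q ^ 2 + 1) < q ^ 3 - 1"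
      using q_gt_1 by (auto simp: power2_eq_square power3_eq_cube algebra_simps dest!: less_imp_Suc_add)
    have "m \<le> (q - 1) * (q ^ 2 + 1)" unfolding m_def using n by (intro mult_le_mono2) auto
    with cube have m_less: "m < q ^ 3 - 1" by linarith
    have m_ge: "q - 1 \<le> m" using n by (simp add: m_def)
    have sq: "q ^ 2 - 1 = (q - 1) * (q + 1)"
      by (simp add: power2_eq_square algebra_simps)
    have m_ge2: "q ^ 2 - 1 \<le> m \<longleftrightarrow> n > q"
      unfolding sq m_def using q_gt_1 mult_le_cancel1[of "q - 1" "q + 1" n] by linarith
    have P0: "?P j = 0" if "j \<le> m" "j \<notin> {0, q - 1, q ^ 2 - 1}" for j
    proof -
      have "Suc j \<noteq> q ^ i" for i
      proof
        assume i: "Suc j = q ^ i"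
        then have "q ^ i < q ^ 3" using that(1) m_less by linarith
        then have "i < 3" using q_gt_1 power_less_imp_less_exp by blast
        then have "i = 0 \<or> i = 1 \<or> i = 2" by auto
        moreover have "j = q ^ i - 1" using i by simp
        ultimately show False using that(2) by auto
      qed
      then have "Suc j \<notin> range (\<lambda>i. q ^ i)" by auto
      then show ?thesis by (simp add: coeff_reduced_carlitz_poly coeff_carlitz_poly_eq_0)
    qed
    have distinct: "0 \<noteq> q - 1" "0 \<noteq> q ^ 2 - 1" "q - 1 \<noteq> q ^ 2 - 1"
      using q_gt_1 power_strict_increasing[of 1 2 q] by auto
    have "0 = (\<Sum>j\<le>m. h (m - j) * ?P j)"
      unfolding h_def by (rule truncated_zeta_convolution[symmetric]) (use m_ge q_gt_1 in simp)
    \<comment> \<open>For n <= q the index q^2 - 1 lies beyond m, hence the case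
      distinction.\<close>
    also have "\<dots> = (\<Sum>j\<in>{0, q - 1} \<union> (if n > q then {q ^ 2 - 1} else {}). h (m - j) * ?P j)"
      using m_ge m_ge2 by (intro sum.mono_neutral_right) (auto simp: P0)
    also have "\<dots> = h m - h (m - (q - 1)) * a - (if n > q then h (m - (q ^ 2 - 1)) * b else 0)"
      using distinct P by (auto simp: insert_commute)
    also have "m - (q - 1) = (q - 1) * (n - 1)"
      by (simp add: m_def diff_mult_distrib2)
    also have "m - (q ^ 2 - 1) = (q - 1) * (n - (q + 1))"
      unfolding sq m_def by (simp only: diff_mult_distrib2)
    finally show ?thesis
      by (auto simp add: g_def m_def mult_ac diff_eq_eq add_ac split: if_splits)
  qed
  have "g (q ^ 2 + 1) = a ^ (q ^ 2 - q) * (a ^ (q + 1) + b)"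
    by (rule recurrence_at_q_square_plus_1) (use g_rec in \<open>auto simp: g_def h_def\<close>)
  moreover have "g (q ^ 2 + 1) = (\<Sum>j<d. power_sum j (int ((q - 1) * (q ^ 2 + 1))))"
    using q_gt_1 by (simp add: g_def h_def sum_nonzero_degree_less_inverse_power del: One_nat_def)
  ultimately show ?thesis by simp
qed

lemma truncated_zeta_closed_form:
  "bracket 1 ^ (q ^ 2 - q + 1) * bracket 2 * (\<Sum>j<d. power_sum j (int ((q - 1) * (q ^ 2 + 1)))) =
     carlitz_coeff d 0 ^ ((q - 1) * (q ^ 2 + 1)) * bracket d ^ q ^ 3 * bracket (Suc d)"
proof -
  define c where "c = carlitz_coeff d 0"
  define B1 B2 X Y :: "'a fls" where "B1 = bracket 1" and "B2 = bracket 2"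
    and "X = bracket d" and "Y = bracket (Suc d)"
  have nz: "c \<noteq> 0" "B1 \<noteq> 0" "B2 \<noteq> 0"
    by (auto simp: c_def B1_def B2_def carlitz_coeff_0_nonzero bracket_nonzero)
  obtain r where q: "q = Suc r" using q_gt_1 by (cases q) auto
  define a b where "a = - (carlitz_coeff d 1 / c)" and "b = - (carlitz_coeff d 2 / c)"
  have a: "B1 * a = c ^ r * X ^ q"
  proof -
    have "B1 * a = - (B1 * carlitz_coeff d 1) / c" by (simp add: a_def)
    also have "\<dots> = c ^ r * X ^ q"
      unfolding B1_def carlitz_coeff_1 using nz
      by (simp add: q power_mult_distrib c_def X_def)
    finally show ?thesis .
  qed
  have b: "B2 * B1 ^ q * b * c = - ((c * X) ^ q ^ 2 * (Y - B2))"
    using carlitz_coeff_2[of d] nz by (simp add: b_def B1_def B2_def c_def X_def Y_def)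
  have XY: "X ^ q = Y - B1" "B1 ^ q = B2 - B1"
    using bracket_power_q[of d] bracket_power_q[of 1]
    by (simp_all add: X_def Y_def B1_def B2_def numeral_2_eq_2)
  \<comment> \<open>The brackets clear the denominators of a^(q+1) and b; the extra c completes the
    exponent (q - 1)(q + 1) + 1 = q^2.\<close>
  have "B1 ^ (q + 1) * B2 * (a ^ (q + 1) + b) * c = B2 * (B1 * a) ^ (q + 1) * c + B1 * (B2 * B1 ^ q * b * c)"
    by (simp add: power_mult_distrib algebra_simps)
  also have "\<dots> = (c * X) ^ q ^ 2 * (B2 * X ^ q - B1 * (Y - B2))"
  proof -
    have "(c ^ r * X ^ q) ^ (q + 1) * c = c ^ (r * (q + 1) + 1) * X ^ (q ^ 2 + q)"
      by (simp add: power_mult_distrib power_add power2_eq_square algebra_simps flip: power_mult)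
    also have "r * (q + 1) + 1 = q ^ 2" by (simp add: q power2_eq_square)
    finally have "(c ^ r * X ^ q) ^ (q + 1) * c = (c * X) ^ q ^ 2 * X ^ q"
      by (simp add: power_add power_mult_distrib)
    then show ?thesis unfolding a b by (simp add: algebra_simps)
  qed
  \<comment> \<open>Substituting X^q = Y - B1, the products B1 B2 cancel and B2 - B1 = B1^q remains,
    which is then divided out.\<close>
  also have "B2 * X ^ q - B1 * (Y - B2) = Y * B1 ^ q"
    by (simp add: XY algebra_simps)
  finally have ab: "B1 * B2 * (a ^ (q + 1) + b) * c = (c * X) ^ q ^ 2 * Y"
    using nz by (simp add: mult_ac)
  have qq: "q ^ 2 - q = q * r" by (simp add: q power2_eq_square)
  have "B1 ^ (q ^ 2 - q + 1) * B2 * (a ^ (q ^ 2 - q) * (a ^ (q + 1) + b)) * c =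
      (B1 * a) ^ (q ^ 2 - q) * (B1 * B2 * (a ^ (q + 1) + b) * c)"
    by (simp add: power_mult_distrib power_add algebra_simps)
  also have "\<dots> = c ^ (r * (q * r) + q ^ 2) * X ^ (q * (q * r) + q ^ 2) * Y"
    unfolding a ab qq by (simp add: power_mult_distrib power_add algebra_simps flip: power_mult)
  also have "r * (q * r) + q ^ 2 = r * (q ^ 2 + 1) + 1" 
    by (simp add: q power2_eq_square algebra_simps)
  also have "q * (q * r) + q ^ 2 = q ^ 3"
    by (simp add: q power2_eq_square power3_eq_cube algebra_simps)
  finally have "B1 ^ (q ^ 2 - q + 1) * B2 * (a ^ (q ^ 2 - q) * (a ^ (q + 1) + b)) =
      c ^ (r * (q ^ 2 + 1)) * X ^ q ^ 3 * Y"
    using nz by (simp add: mult_ac)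
  then show ?thesis
    unfolding truncated_zeta_eq_coeff_ratio
    by (simp add: B1_def B2_def a_def b_def c_def X_def Y_def q)
qed

section \<open>Telescoping of the double and triple sums\<close>

lemma carlitz_coeff_frobenius:
  "(carlitz_coeff (Suc d) 0 * bracket (Suc d)) ^ q ^ k = - (carlitz_coeff d 0 ^ q ^ k)"
  by (simp only: carlitz_coeff_0_Suc frobenius_power_minus)

definition truncated_double_zeta :: "nat \<Rightarrow> 'a fls" where
  "truncated_double_zeta d = (\<Sum>i<d. power_sum i (int (q * (q - 1))) *
     (\<Sum>j<i. power_sum j (int ((q - 1) * (q ^ 2 + 1)))))"

text \<open>The factor \<open>carlitz_coeff d 0\<close> is S_d(1), by which the outermost sum
  multiplies. The next term removes -[3] from the difference, and the passage to d + 1 restores it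
  through the Frobenius rule for brackets.\<close>

lemma truncated_double_zeta_closed_form:
  "bracket 3 * bracket 2 * bracket 1 ^ (q ^ 2 - q + 1) *
     (carlitz_coeff d 0 * truncated_double_zeta d) =
   (carlitz_coeff d 0 * bracket d) ^ q ^ 3 * (bracket (d + 2) - bracket 3) * bracket (d + 1)"
proof (induction d)
  case 0
  then show ?case using q_gt_1 by (simp add: truncated_double_zeta_def power_0_left)
next
  case (Suc d)
  let ?C = "bracket 1 ^ (q ^ 2 - q + 1) * bracket 2 :: 'a fls"
  define c where "c = carlitz_coeff d 0"
  define v where "v = (\<lambda>d. bracket 3 * bracket 2 * bracket 1 ^ (q ^ 2 - q + 1) * truncated_double_zeta d)"
  define e1 e2 where "e1 = q * (q - 1)" and "e2 = (q - 1) * (q ^ 2 + 1)"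
  \<comment> \<open>The two exponents and the extra factor c add up to q^3, so the new term has the
    same power of c as the induction hypothesis.\<close>
  have exp: "q ^ 3 = 1 + e1 + e2" unfolding e1_def e2_def
    using q_gt_1 by (auto simp: power2_eq_square power3_eq_cube algebra_simps dest!: less_imp_Suc_add)
  \<comment> \<open>The closed form reaches only up to q, so S_d(q (q - 1)) is taken as the q-th
    power of S_d(q - 1).\<close>
  have "power_sum d (int ((q - 1) * q ^ 1)) = (c ^ (q - 1)) ^ q ^ 1"
    unfolding power_sum_frobenius c_def using q_gt_1 by (subst power_sum_small) auto
  then have mid: "power_sum d (int e1) = c ^ e1"
    by (simp add: e1_def mult.commute flip: power_mult)
  have low: "?C * (\<Sum>j<d. power_sum j (int e2)) = c ^ e2 * bracket d ^ q ^ 3 * bracket (Suc d)"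
    using truncated_zeta_closed_form[of d] by (simp only: e2_def c_def)
  have "v (Suc d) = v d + bracket 3 * power_sum d (int e1) * (?C * (\<Sum>j<d. power_sum j (int e2)))"
  proof -
    have "truncated_double_zeta (Suc d) = truncated_double_zeta d +
        power_sum d (int e1) * (\<Sum>j<d. power_sum j (int e2))"
      by (simp only: truncated_double_zeta_def sum.lessThan_Suc e1_def e2_def)
    then show ?thesis by (simp add: v_def algebra_simps)
  qed
  then have "c * v (Suc d) = c * v d + bracket 3 * c ^ q ^ 3 * bracket d ^ q ^ 3 * bracket (Suc d)"
    unfolding low mid by (simp add: exp power_add algebra_simps)
  also have "c * v d = (c * bracket d) ^ q ^ 3 * (bracket (d + 2) - bracket 3) * bracket (d + 1)"
    using Suc by (simp add: v_def c_def mult_ac)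
  finally have "c * v (Suc d) = (c * bracket d) ^ q ^ 3 * bracket (d + 2) * bracket (Suc d)"
    by (simp add: power_mult_distrib algebra_simps)
  moreover have "c = - (carlitz_coeff (Suc d) 0 * bracket (Suc d))"
    unfolding carlitz_coeff_0_Suc c_def by simp
  then have "carlitz_coeff (Suc d) 0 * v (Suc d) * bracket (Suc d) = - (c * v (Suc d))"
    by (metis minus_minus minus_mult_left mult.assoc mult.commute)
  ultimately have "carlitz_coeff (Suc d) 0 * v (Suc d) * bracket (Suc d) =
      - ((c * bracket d) ^ q ^ 3 * bracket (d + 2)) * bracket (Suc d)"
    by (simp only: minus_mult_left)
  then have "carlitz_coeff (Suc d) 0 * v (Suc d) = - ((c * bracket d) ^ q ^ 3 * bracket (d + 2))"
    using bracket_nonzero[of "Suc d"] mult_right_cancel by blast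
  also have "\<dots> = - (c ^ q ^ 3) * bracket d ^ q ^ 3 * bracket (d + 2)"
    by (simp add: power_mult_distrib)
  \<comment> \<open>The substitution [d]^(q^3) = [d + 3] - [3] recovers the difference in the claim
    for d + 1.\<close>
  finally have "carlitz_coeff (Suc d) 0 * v (Suc d) =
      - (c ^ q ^ 3) * (bracket (d + 3) - bracket 3) * bracket (d + 2)"
    by (simp only: bracket_frobenius)
  moreover have "Suc d + 2 = d + 3" "Suc d + 1 = d + 2" by simp_all
  ultimately show ?case
    unfolding carlitz_coeff_frobenius by (simp only: v_def c_def mult_ac)
qed

text \<open>With [d + 4] - [3] = [d + 1]^(q^3), two bracket powers are absorbed by c_(k+1) [k + 1] =
  -c_k for k = d + 1 and k = d, and the signs cancel.\<close>

lemma truncated_double_zeta_add_2: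
  "bracket 3 * bracket 2 * bracket 1 ^ (q ^ 2 - q + 1) *
     (carlitz_coeff (d + 2) 0 * truncated_double_zeta (d + 2)) =
   carlitz_coeff d 0 ^ q ^ 3 * bracket (d + 3)"
proof -
  have "d + 2 + 2 = Suc d + 3" by simp
  then have "(bracket (d + 2 + 2) - bracket 3 :: 'a fls) = bracket (Suc d) ^ q ^ 3"
    by (simp only: bracket_frobenius)
  moreover have "(carlitz_coeff (d + 2) 0 * bracket (d + 2)) ^ q ^ 3 * bracket (Suc d) ^ q ^ 3 =
      carlitz_coeff d 0 ^ q ^ 3"
    using carlitz_coeff_frobenius[of d 3] carlitz_coeff_frobenius[of "Suc d" 3]
    unfolding power_mult_distrib by (simp add: numeral_2_eq_2 del: carlitz_coeff.simps)
  moreover have "d + 2 + 1 = d + 3" by simp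
  ultimately show ?thesis
    unfolding truncated_double_zeta_closed_form by (simp only:)
qed

text \<open>The outer term of index n + 3 becomes [3] S_(n+1)(q^3) - S_n(q^3). So each S_d(q^3) but
  the last is counted [3] - 1 times, and the last one is a boundary term that tends to 0.\<close>

lemma truncated_triple_zeta:
  "bracket 3 * bracket 2 * bracket 1 ^ (q ^ 2 - q + 1) *
     (\<Sum>d<n + 3. power_sum d 1 * truncated_double_zeta d) =
   (bracket 3 - 1) * (\<Sum>d<n. power_sum d (int (q ^ 3))) + bracket 3 * power_sum n (int (q ^ 3))"
proof -
  let ?D = "bracket 3 * bracket 2 * bracket 1 ^ (q ^ 2 - q + 1) :: 'a fls"
  have c1: "power_sum d 1 = carlitz_coeff d 0" for d
    using power_sum_small[of 1 d] q_gt_1 by simp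
  have cq: "power_sum d (int (q ^ 3)) = carlitz_coeff d 0 ^ q ^ 3" for d
    using power_sum_frobenius[of d 1 3] by (simp add: c1)
  show ?thesis
  proof (induction n)
    case 0
    \<comment> \<open>The terms at 0 and 1 vanish because their nested sums are empty; index 2 is
      the first to contribute.\<close>
    have "{..<0 + 3} = {0, 1, 0 + 2 :: nat}" by auto
    then have "?D * (\<Sum>d<0 + 3. power_sum d 1 * truncated_double_zeta d) =
        ?D * (carlitz_coeff (0 + 2) 0 * truncated_double_zeta (0 + 2))"
      by (simp add: c1 truncated_double_zeta_def del: carlitz_coeff.simps)
    also have "\<dots> = bracket 3"
      unfolding truncated_double_zeta_add_2 by simp
    finally show ?case using cq[of 0] by simp
  next
    case (Suc n)
    have "(\<Sum>d<Suc n + 3. power_sum d 1 * truncated_double_zeta d) =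
        (\<Sum>d<n + 3. power_sum d 1 * truncated_double_zeta d) +
        carlitz_coeff (n + 3) 0 * truncated_double_zeta (n + 3)"
      unfolding add_Suc sum.lessThan_Suc c1 ..
    moreover have "?D * (carlitz_coeff (n + 3) 0 * truncated_double_zeta (n + 3)) =
        carlitz_coeff (Suc n) 0 ^ q ^ 3 * (bracket (Suc n) ^ q ^ 3 + bracket 3)"
    proof -
      have "Suc n + 2 = n + 3" by simp
      moreover have "bracket (Suc n + 3) = bracket (Suc n) ^ q ^ 3 + (bracket 3 :: 'a fls)"
        by (simp only: bracket_frobenius diff_add_cancel)
      ultimately show ?thesis
        using truncated_double_zeta_add_2[of "Suc n"] by (simp only:)
    qed
    moreover have "\<dots> = bracket 3 * power_sum (Suc n) (int (q ^ 3)) - power_sum n (int (q ^ 3))"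
      using carlitz_coeff_frobenius[of n 3]
      unfolding cq by (simp add: power_mult_distrib algebra_simps del: carlitz_coeff.simps)
    ultimately have "?D * (\<Sum>d<Suc n + 3. power_sum d 1 * truncated_double_zeta d) =
        ?D * (\<Sum>d<n + 3. power_sum d 1 * truncated_double_zeta d) +
        (bracket 3 * power_sum (Suc n) (int (q ^ 3)) - power_sum n (int (q ^ 3)))"
      by (simp only: distrib_left)
    then show ?case unfolding Suc by (simp add: algebra_simps)
  qed
qed

section \<open>Passage to the limit\<close>

lemma multizeta_eq_carlitz_zeta:
  "bracket 3 * bracket 2 * bracket 1 ^ (q ^ 2 - q + 1) *
     multizeta [1, int (q * (q - 1)), int ((q - 1) * (q ^ 2 + 1))] =
   (bracket 3 - 1) * (carlitz_zeta (int (q ^ 3)) :: 'a fls)"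
proof -
  let ?D = "bracket 3 * bracket 2 * bracket 1 ^ (q ^ 2 - q + 1) :: 'a fls"
  let ?M = "multizeta [1, int (q * (q - 1)), int ((q - 1) * (q ^ 2 + 1))] :: 'a fls"
  let ?Z = "carlitz_zeta (int (q ^ 3)) :: 'a fls"
  define M where "M = (\<lambda>n. \<Sum>d<n + 3. power_sum d 1 * truncated_double_zeta d)"
  define Z where "Z = (\<lambda>n. \<Sum>d<n. power_sum d (int (q ^ 3)) :: 'a fls)"
  define z where "z = (\<lambda>n. power_sum n (int (q ^ 3)) :: 'a fls)"
  have M: "fls_nth (?M - M n) k = 0" if "k < int n" for k n
  proof -
    have pos: "int (q * (q - 1)) > 0" "int ((q - 1) * (q ^ 2 + 1)) > 0"
      unfolding of_nat_0_less_iff using q_gt_1 by auto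
    have "fls_nth ?M k = fls_nth (M n) k"
      unfolding M_def truncated_double_zeta_def
      by (rule fls_nth_multizeta_depth_3[OF _ pos]) (use that in auto)
    then show ?thesis by simp
  qed
  have Z: "fls_nth (?Z - Z n) k = 0" if "k < int n" for k n
    using fls_nth_carlitz_zeta[of "int (q ^ 3)" k n, where 'a = 'a] that q_gt_1 by (simp add: Z_def)
  have z: "fls_nth (z n) k = 0" if "k < int n" for k n
  proof -
    have "int n * 1 \<le> int n * int (q ^ 3)" using q_gt_1 by (intro mult_left_mono) auto
    then show ?thesis using that unfolding z_def by (intro fls_nth_power_sum_eq_0) linarith
  qed
  have mult: "fls_nth (x * y) k = 0"
    if "\<And>k. k < int n \<Longrightarrow> fls_nth y k = 0" "k < int n + fls_subdegree x" for x y :: "'a fls" and n k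
    by (rule fls_nth_mult_eq_0[of "fls_subdegree x" x "int n"]) (use that in auto)
  \<comment> \<open>The finite identity leaves three error terms whose orders grow with n, while the
    fixed factors shift orders by constants.\<close>
  have "fls_nth (?D * ?M - (bracket 3 - 1) * ?Z) k = 0" for k
  proof -
    \<comment> \<open>This n outweighs the shift of every factor, so k lies below the order of all
      three error terms.\<close>
    define n where "n = nat (\<bar>k\<bar> + \<bar>fls_subdegree ?D\<bar> + \<bar>fls_subdegree (bracket 3 :: 'a fls)\<bar> +
      \<bar>fls_subdegree (bracket 3 - 1 :: 'a fls)\<bar> + 1)"
    have "?D * ?M - (bracket 3 - 1) * ?Z =
        ?D * (?M - M n) - (bracket 3 - 1) * (?Z - Z n) + bracket 3 * z n"
      using truncated_triple_zeta[of n] by (simp add: M_def Z_def z_def algebra_simps)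
    moreover have "fls_nth (?D * (?M - M n)) k = 0"
      by (rule mult[of n]) (use M in \<open>auto simp: n_def\<close>)
    moreover have "fls_nth ((bracket 3 - 1) * (?Z - Z n)) k = 0"
      by (rule mult[of n]) (use Z in \<open>auto simp: n_def\<close>)
    moreover have "fls_nth (bracket 3 * z n) k = 0"
      by (rule mult[of n]) (use z in \<open>auto simp: n_def\<close>)
    ultimately show ?thesis by simp
  qed
  then have "?D * ?M - (bracket 3 - 1) * ?Z = 0" by (intro fls_eqI) simp
  then show ?thesis by simp
qed

end

theorem theorem4p7:
  fixes q :: nat
  assumes "q = CARD('a :: {finite, field})" and "q > 2"
  shows "zeta_like TYPE('a) [1, int q * (int q - 1), int q ^ 3 - int q ^ 2 + int q - 1] \<and>
    (multizeta [1, int q * (int q - 1), int q ^ 3 - int q ^ 2 + int q - 1] :: 'a fls) =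
      (bracket 3 - 1) / (bracket 3 * bracket 2 * bracket 1 ^ (q ^ 2 - q + 1)) *
      carlitz_zeta (int q ^ 3)"
proof -
  let ?D = "bracket 3 * bracket 2 * bracket 1 ^ (q ^ 2 - q + 1) :: 'a fls"
  let ?ss = "[1, int q * (int q - 1), int q ^ 3 - int q ^ 2 + int q - 1]"
  obtain r where r: "q = Suc r" using assms(2) by (cases q) auto
  \<comment> \<open>The last entry factors as (q - 1)(q^2 + 1); q = r + 1 lets natural and integer
    subtraction agree.\<close>
  have ss: "?ss = [1, int (q * (q - 1)), int ((q - 1) * (q ^ 2 + 1))]"
    by (simp add: r power2_eq_square power3_eq_cube algebra_simps)
  have D: "?D \<noteq> 0"
    using bracket_nonzero[OF assms(1)] by simp
  have "?D * multizeta ?ss = (bracket 3 - 1) * carlitz_zeta (int q ^ 3)"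
    using multizeta_eq_carlitz_zeta[OF assms(1)] unfolding ss by simp
  then have eq: "multizeta ?ss = (bracket 3 - 1) / ?D * carlitz_zeta (int q ^ 3)"
    using D by (simp add: nonzero_eq_divide_eq mult.commute del: mult_eq_0_iff)
  have "sum_list ?ss = int q ^ 3"
    by (simp add: power2_eq_square algebra_simps)
  moreover have "(carlitz_zeta (int q ^ 3) :: 'a fls) \<noteq> 0"
    using assms by (intro carlitz_zeta_nonzero) simp
  ultimately have ratio: "multizeta ?ss / carlitz_zeta (sum_list ?ss) = (bracket 3 - 1) / ?D"
    by (simp only: eq) simp
  \<comment> \<open>Membership in K needs numerator and denominator as images of polynomials, so the
    brackets are lifted to polynomials.\<close>
  define b :: "nat \<Rightarrow> 'a poly" where "b = (\<lambda>k. [:0, 1:] ^ (CARD('a) ^ k) - [:0, 1:])"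
  have b: "bracket k = poly_emb (b k)" for k
    by (simp add: b_def bracket_eq_poly_emb)
  have num: "bracket 3 - 1 = poly_emb (b 3 - 1)"
    by (simp add: b poly_emb_diff)
  have den: "?D = poly_emb (b 3 * b 2 * b 1 ^ (q ^ 2 - q + 1))"
    by (simp only: b poly_emb_mult poly_emb_power)
  with D have "b 3 * b 2 * b 1 ^ (q ^ 2 - q + 1) \<noteq> 0" by (metis poly_emb_0)
  then have "(bracket 3 - 1) / ?D \<in> ratfun_field"
    unfolding ratfun_field_def num den by blast
  then have "zeta_like TYPE('a) ?ss"
    unfolding zeta_like_def ratio .
  with eq show ?thesis by blast
qed

end
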